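(* Let $\Pi=\Pi_n$ be a prior distribution on $\eta$, let $\alpha_n\in(0,1]$ with $n\alpha_n\to\infty$, and let $\eta_0$ be the true parameter. Let $(\mathcal H,\langle\cdot,\cdot\rangle_L)$ be a Hilbert space with norm $\|\cdot\|_L$ and suppose the following hold. (LAN expansion) For $\eta$ with $\eta-\eta_0\in\mathcal H$, the log-likelihood can be written $$\ell_n(\eta)=\ell_n(\eta_0)-\tfrac n2\|\eta-\eta_0\|_L^2+\sqrt n\,W_n(\eta-\eta_0)+R_n(\eta,\eta_0),$$ where $h\mapsto W_n(h)$ is $P_0$-almost surely a linear map on $\mathcal H$ and, for each $h$, $W_n(h)$ converges weakly to $\mathcal N(0,\|h\|_L^2)$ as $n\to\infty$. (Functional expansion) The functional $\psi:S\to\mathbb R$ satisfies, for some $\psi_0\in\mathcal H$, $$\psi(\eta)-\psi(\eta_0)=\langle\psi_0,\eta-\eta_0\rangle_L+r(\eta,\eta_0).$$ (Remainder control) For $t\in\mathbb R$ set $\eta_t=\eta-\frac{t\psi_0}{\sqrt{n\alpha_n}}$. There is a sequence of measurable sets $A_n$ with $\Pi_{\alpha_n}(A_n\mid Y^n)=1+o_P(1)$, such that $\eta-\eta_0\in\mathcal H$ for all $\eta\in A_n$ and $n$ sufficiently large, and for every fixed $t\in\mathbb R$, $$\sup_{\eta\in A_n}\big|t\sqrt{n\alpha_n}\,r(\eta,\eta_0)+\alpha_n\big(R_n(\eta,\eta_0)-R_n(\eta_t,\eta_0)\big)\big|=o_P(1).$$ Define $\hat\psi=\psi(\eta_0)+W_n(\psi_0)/\sqrt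 n$ and $V_0=\|\psi_0\|_L^2$. Then for any $t\in\mathbb R$, $$E_{\alpha_n}\big(e^{t\sqrt{n\alpha_n}(\psi(\eta)-\hat\psi)}\mid Y^n,A_n\big)=e^{o_P(1)+t^2V_0/2}\cdot\frac{\int_{A_n}e^{\alpha_n\ell_n(\eta_t)}\,d\Pi(\eta)}{\int e^{\alpha_n\ell_n(\eta)}\,d\Pi(\eta)}.$$ Furthermore, if for any $t\in\mathbb R$ $$\frac{\int_{A_n}e^{\alpha_n\ell_n(\eta_t)}\,d\Pi(\eta)}{\int e^{\alpha_n\ell_n(\eta)}\,d\Pi(\eta)}=1+o_P(1),$$ then the $\alpha_n$-posterior distribution of $\sqrt{n\alpha_n}(\psi(\eta)-\hat\psi)$ converges weakly in $P_0$-probability to a Gaussian distribution with mean $0$ and variance $V_0$.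
   Context: $(\mathcal Y^n,\mathcal A^n,P^n_\eta:\eta\in S)$ is a sequence of dominated statistical experiments with observation $Y^n$, densities $p^n_\eta$ and log-likelihood $\ell_n(\eta)=\log p^n_\eta(Y^n)$. $P_0=P^n_{\eta_0}$, and $o_P(1)$ denotes a term tending to $0$ in $P_0$-probability. The $\alpha_n$-posterior is $$\Pi_{\alpha_n}(B\mid Y^n)=\frac{\int_Be^{\alpha_n\ell_n(\eta)}d\Pi(\eta)}{\int_Se^{\alpha_n\ell_n(\eta)}d\Pi(\eta)}.$$ For measurable $A_n$, $E_{\alpha_n}(G(\eta)\mid Y^n,A_n)=\int_{A_n}G(\eta)\,d\Pi_{\alpha_n}(\eta\mid Y^n)/\Pi_{\alpha_n}(A_n\mid Y^n)$. A data-dependent law $Q_Y$ on $\mathbb R$ converges weakly in $P_0$-probability to $\mathcal N(0,V)$ if $d_{BL}(Q_Y,\mathcal N(0,V))\to0$ in $P_0$-probability, where $d_{BL}$ is the bounded Lipschitz distance; the $\alpha_n$-posterior distribution of a function of $\eta$ is the push-forward of $\Pi_{\alpha_n}(\cdot\mid Y^n)$ by that function. *)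

theory Defs
  imports "HOL-Probability.Probability"
begin

text \<open>An experiment on the sample space of \<open>\<nu>\<close>, indexed by \<open>\<eta> \<in> S\<close>, with laws \<open>P \<eta>\<close> that
  have densities \<open>p \<eta>\<close> with respect to the \<open>\<sigma>\<close>-finite measure \<open>\<nu>\<close>.\<close>

definition dominated_experiment ::
    "'v set \<Rightarrow> 'y measure \<Rightarrow> ('v \<Rightarrow> 'y measure) \<Rightarrow> ('v \<Rightarrow> 'y \<Rightarrow> real) \<Rightarrow> bool" where
  "dominated_experiment S \<nu> P p \<longleftrightarrow>
     sigma_finite_measure \<nu> \<and>
     (\<forall>\<eta>\<in>S. p \<eta> \<in> borel_measurable \<nu> \<and> (\<forall>y\<in>space \<nu>. 0 \<le> p \<eta> y) \<and>
        P \<eta> = density \<nu> (\<lambda>y. ennreal (p \<eta> y)) \<and> prob_space (P \<eta>))"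

text \<open>The log-likelihood is extended-real valued, because \<open>ln 0 = 0\<close> in HOL; a vanishing density
  has log-likelihood \<open>-\<infinity>\<close> and contributes \<open>exp (-\<infinity>) = 0\<close> to the posterior.\<close>

definition loglik :: "('v \<Rightarrow> 'y \<Rightarrow> real) \<Rightarrow> 'v \<Rightarrow> 'y \<Rightarrow> ereal" where
  "loglik p \<eta> y = (if 0 < p \<eta> y then ereal (ln (p \<eta> y)) else -\<infinity>)"

definition exp_ext :: "ereal \<Rightarrow> ennreal" where
  "exp_ext x = (if x = \<infinity> then \<infinity> else if x = -\<infinity> then 0
     else ennreal (exp (real_of_ereal x)))"

definition frac_lik :: "real \<Rightarrow> ('v \<Rightarrow> 'y \<Rightarrow> real) \<Rightarrow> 'v \<Rightarrow> 'y \<Rightarrow> ennreal" where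
  "frac_lik \<alpha> p \<eta> y = exp_ext (ereal \<alpha> * loglik p \<eta> y)"

lemma frac_lik_eq_powr:
  assumes "0 < \<alpha>" "0 \<le> p \<eta> y"
  shows "frac_lik \<alpha> p \<eta> y = ennreal (p \<eta> y powr \<alpha>)"
  using assms by (auto simp: frac_lik_def loglik_def exp_ext_def powr_def)

definition frac_posterior ::
    "real \<Rightarrow> 'v measure \<Rightarrow> ('v \<Rightarrow> 'y \<Rightarrow> real) \<Rightarrow> 'y \<Rightarrow> 'v measure" where
  "frac_posterior \<alpha> prior p y =
     density prior (\<lambda>\<eta>. frac_lik \<alpha> p \<eta> y / (\<integral>\<^sup>+\<theta>. frac_lik \<alpha> p \<theta> y \<partial>prior))"

text \<open>Expectation of a nonnegative \<open>G\<close> under \<open>M\<close> restricted to \<open>A\<close> and renormalised.\<close>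

definition restricted_expectation :: "'v measure \<Rightarrow> 'v set \<Rightarrow> ('v \<Rightarrow> real) \<Rightarrow> ennreal" where
  "restricted_expectation M A G = (\<integral>\<^sup>+\<eta>\<in>A. ennreal (G \<eta>) \<partial>M) / emeasure M A"

text \<open>The point \<open>\<eta> - t \<psi>\<^sub>0 / sqrt s\<close>; the Hilbert space \<open>'h\<close> sits in the ambient vector space
  through the linear injection \<open>\<iota>\<close>.\<close>

definition shift ::
    "('h::real_inner \<Rightarrow> 'v::real_vector) \<Rightarrow> 'h \<Rightarrow> real \<Rightarrow> real \<Rightarrow> 'v \<Rightarrow> 'v" where
  "shift \<iota> \<psi>\<^sub>0 s t \<eta> = \<eta> - (t / sqrt s) *\<^sub>R \<iota> \<psi>\<^sub>0"

definition shifted_ratio ::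
    "real \<Rightarrow> 'v measure \<Rightarrow> ('v \<Rightarrow> 'y \<Rightarrow> real) \<Rightarrow> 'v set \<Rightarrow> ('v \<Rightarrow> 'v) \<Rightarrow> 'y \<Rightarrow> ennreal" where
  "shifted_ratio \<alpha> prior p A \<tau> y =
     (\<integral>\<^sup>+\<eta>\<in>A. frac_lik \<alpha> p (\<tau> \<eta>) y \<partial>prior) / (\<integral>\<^sup>+\<eta>. frac_lik \<alpha> p \<eta> y \<partial>prior)"

text \<open>Convergence to \<open>0\<close> in probability along a sequence of probability spaces. Outer measure is
  used because quantities such as suprema over \<open>A\<^sub>n\<close> need not be measurable in the data; for
  measurable quantities it is the usual notion.\<close>

definition oP :: "(nat \<Rightarrow> 'y measure) \<Rightarrow> (nat \<Rightarrow> 'y \<Rightarrow> ereal) \<Rightarrow> bool" where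
  "oP P X \<longleftrightarrow> (\<forall>\<epsilon>::real. 0 < \<epsilon> \<longrightarrow>
     (\<lambda>n. outer_measure_of (P n) {y \<in> space (P n). ereal \<epsilon> < \<bar>X n y\<bar>}) \<longlonglongrightarrow> 0)"

definition with_prob_tending_to_1 :: "(nat \<Rightarrow> 'y measure) \<Rightarrow> (nat \<Rightarrow> 'y \<Rightarrow> bool) \<Rightarrow> bool" where
  "with_prob_tending_to_1 P E \<longleftrightarrow>
     (\<lambda>n. outer_measure_of (P n) {y \<in> space (P n). \<not> E n y}) \<longlonglongrightarrow> 0"

text \<open>\<open>normal_density \<mu> 0\<close> vanishes identically in the library, so the degenerate Gaussian law
  is treated separately. The second parameter is the variance.\<close>

definition gaussian :: "real \<Rightarrow> real \<Rightarrow> real measure" where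
  "gaussian \<mu> V = (if V = 0 then return borel \<mu>
     else density lborel (\<lambda>x. ennreal (normal_density \<mu> (sqrt V) x)))"

definition bl_dist :: "real measure \<Rightarrow> real measure \<Rightarrow> real" where
  "bl_dist Q Q' = (SUP f\<in>{f :: real \<Rightarrow> real. 1-lipschitz_on UNIV f \<and> (\<forall>x. \<bar>f x\<bar> \<le> 1)}.
     \<bar>(LINT x|Q. f x) - (LINT x|Q'. f x)\<bar>)"

definition weak_conv_in_prob ::
    "(nat \<Rightarrow> 'y measure) \<Rightarrow> (nat \<Rightarrow> 'y \<Rightarrow> real measure) \<Rightarrow> real measure \<Rightarrow> bool" where
  "weak_conv_in_prob P Q N \<longleftrightarrow> oP P (\<lambda>n y. ereal (bl_dist (Q n y) N))"

end

theory Submission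
  imports Defs "HOL-Complex_Analysis.Cauchy_Integral_Formula"
begin

text \<open>Expanding the likelihood at \<open>\<eta>\<close> and at \<open>\<eta>\<^sub>t\<close> and completing the square turns
  \<open>exp (t * sqrt (n * \<alpha>) * (\<psi> \<eta> - \<psi>hat))\<close> times the fractional likelihood at \<open>\<eta>\<close> into
  \<open>exp (t\<^sup>2 * V\<^sub>0 / 2)\<close> times the fractional likelihood at \<open>\<eta>\<^sub>t\<close>, up to the exponential of the
  quantity that the remainder condition bounds on \<open>A\<^sub>n\<close>. Integrating over \<open>A\<^sub>n\<close> gives the
  Laplace transform of the restricted posterior. When the ratio tends to 1, that transform tends
  pointwise to the Gaussian one. By compactness, for each \<open>\<epsilon>\<close> closeness at finitely many \<open>t\<close>
  already forces a bounded Lipschitz distance below \<open>\<epsilon>\<close>, so pointwise convergence in probability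
  suffices; restricting to \<open>A\<^sub>n\<close> costs at most twice the posterior mass outside.\<close>

section \<open>Moment generating functions and weak convergence\<close>

text \<open>Any real \<open>a\<close> lies below a rational \<open>q\<close>, and
  \<open>exp (q * \<bar>x\<bar>)\<close> is dominated by the sum of the two exponentials at
  \<open>q\<close> and \<open>- q\<close>. Rational exponents are singled out because the later
  compactness argument enumerates its test points.\<close>

lemma integrable_exp_rat_imp_real:
  fixes M :: "real measure"
  assumes [measurable_cong]: "sets M = sets borel"
    and rat: "\<And>t. t \<in> \<rat> \<Longrightarrow> integrable M (\<lambda>x. exp (t * x))"
  shows "integrable M (\<lambda>x. exp (a * \<bar>x\<bar>))"
proof -
  obtain q where q: "q \<in> \<rat>" "a < q"
    using Rats_dense_in_real[of a "a + 1"] by auto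
  have "integrable M (\<lambda>x. exp (q * x) + exp (- q * x))"
    using q by (intro Bochner_Integration.integrable_add rat) auto
  then show ?thesis
  proof (rule Bochner_Integration.integrable_bound)
    have "exp (a * \<bar>x\<bar>) \<le> exp (q * x) + exp (- q * x)" for x
    proof -
      have "exp (a * \<bar>x\<bar>) \<le> exp (q * \<bar>x\<bar>)"
        using q by (simp add: mult_right_mono)
      also have "\<dots> \<le> exp (q * x) + exp (- q * x)"
        by (cases "0 \<le> x") auto
      finally show ?thesis .
    qed
    then show "AE x in M. norm (exp (a * \<bar>x\<bar>)) \<le> norm (exp (q * x) + exp (- q * x))"
      by (intro always_eventually) (smt (verit) exp_gt_zero real_norm_def)
  qed measurable
qed

lemma sum_power_div_fact_le_exp:
  fixes u :: real
  assumes "0 \<le> u"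
  shows "(\<Sum>k<n. u ^ k / fact k) \<le> exp u"
proof -
  have s: "(\<lambda>k. u ^ k / fact k) sums exp u"
    using exp_converges[of u] by (simp add: divide_inverse mult.commute)
  then show ?thesis
    using sum_le_suminf[of "\<lambda>k. u ^ k / fact k" "{..<n}"] assms
    by (simp add: sums_iff)
qed

text \<open>The exponential series may be integrated term by term: the partial sums of the norms
  stay below \<open>exp (norm z * \<bar>x\<bar>)\<close>, which is integrable. The transform is thus
  entire, with the moments over factorials as coefficients.\<close>

lemma mgf_power_series:
  fixes M :: "real measure" and z :: complex
  assumes [measurable_cong]: "sets M = sets borel"
    and exp_int: "\<And>a. integrable M (\<lambda>x. exp (a * \<bar>x\<bar>))"
  shows "(\<lambda>k. complex_of_real ((LINT x|M. x ^ k) / fact k) * z ^ k) sums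
    (CLINT x|M. exp (z * of_real x))"
proof -
  let ?f = "\<lambda>k x. (z * complex_of_real x) ^ k / fact k"
  have nrm: "norm (?f k x) = (norm z * \<bar>x\<bar>) ^ k / fact k" for k x
    by (simp add: norm_divide norm_power norm_mult)
  have mono: "integrable M (\<lambda>x. \<bar>x\<bar> ^ k)" for k
  proof (rule Bochner_Integration.integrable_bound)
    show "integrable M (\<lambda>x. fact k * exp (1 * \<bar>x\<bar>))"
      using exp_int[of 1] by simp
    \<comment> \<open>One term of the exponential series is at most the whole sum.\<close>
    have "\<bar>x\<bar> ^ k \<le> fact k * exp \<bar>x\<bar>" for x :: real
    proof -
      have "\<bar>x\<bar> ^ k / fact k \<le> (\<Sum>j<Suc k. \<bar>x\<bar> ^ j / fact j)"
        by (simp add: sum_nonneg)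
      also have "\<dots> \<le> exp \<bar>x\<bar>"
        by (rule sum_power_div_fact_le_exp) simp
      finally show ?thesis
        by (simp add: field_simps)
    qed
    then show "AE x in M. norm (\<bar>x\<bar> ^ k) \<le> norm (fact k * exp (1 * \<bar>x\<bar>))"
      by simp
  qed measurable
  have int: "integrable M (?f k)" for k
  proof (rule Bochner_Integration.integrable_bound)
    show "integrable M (\<lambda>x. norm z ^ k / fact k * \<bar>x\<bar> ^ k)"
      using mono[of k] by simp
    show "AE x in M. norm (?f k x) \<le> norm (norm z ^ k / fact k * \<bar>x\<bar> ^ k)"
      unfolding nrm by (simp add: power_mult_distrib)
  qed measurable
  have smble: "summable (\<lambda>k. norm (?f k x))" for x
    unfolding nrm using summable_exp[of "norm z * \<bar>x\<bar>"]
    by (simp add: divide_inverse mult.commute)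
  have smint: "summable (\<lambda>k. LINT x|M. norm (?f k x))"
  proof (rule summableI_nonneg_bounded)
    fix n
    have "(\<Sum>k<n. LINT x|M. norm (?f k x)) = (LINT x|M. (\<Sum>k<n. norm (?f k x)))"
      using int by (intro Bochner_Integration.integral_sum[symmetric]) auto
    also have "\<dots> \<le> (LINT x|M. exp (norm z * \<bar>x\<bar>))"
    proof (rule integral_mono)
      show "integrable M (\<lambda>x. \<Sum>k<n. norm (?f k x))"
        using int by auto
      show "(\<Sum>k<n. norm (?f k x)) \<le> exp (norm z * \<bar>x\<bar>)" for x
        unfolding nrm by (rule sum_power_div_fact_le_exp) simp
    qed (rule exp_int)
    finally show "(\<Sum>k<n. LINT x|M. norm (?f k x)) \<le> (LINT x|M. exp (norm z * \<bar>x\<bar>))" .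
  qed (auto intro: integral_nonneg_AE)
  have "(\<lambda>k. integral\<^sup>L M (?f k)) sums (CLINT x|M. (\<Sum>k. ?f k x))"
    using int smble smint by (intro sums_integral) auto
  moreover have "(\<Sum>k. ?f k x) = exp (z * of_real x)" for x
    by (simp add: exp_def scaleR_conv_of_real divide_inverse mult.commute)
  moreover have "integral\<^sup>L M (?f k) = complex_of_real ((LINT x|M. x ^ k) / fact k) * z ^ k" for k
  proof -
    have "?f k = (\<lambda>x. (z ^ k / fact k) * complex_of_real (x ^ k))"
      by (auto simp: fun_eq_iff power_mult_distrib)
    then have "integral\<^sup>L M (?f k) = (z ^ k / fact k) * (CLINT x|M. complex_of_real (x ^ k))"
      by (simp del: of_real_power)
    also have "(CLINT x|M. complex_of_real (x ^ k)) = complex_of_real (LINT x|M. x ^ k)"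
      by (rule integral_complex_of_real)
    finally show ?thesis
      by simp
  qed
  ultimately show ?thesis
    by simp
qed

text \<open>The moment generating functions are entire, so agreement at the points \<open>1 / n\<close> forces equal
  moments; hence the characteristic functions agree as well.\<close>

lemma mgf_uniqueness:
  fixes M N :: "real measure"
  assumes M: "real_distribution M" and N: "real_distribution N"
    and intM: "\<And>t. t \<in> \<rat> \<Longrightarrow> integrable M (\<lambda>x. exp (t * x))"
    and intN: "\<And>t. t \<in> \<rat> \<Longrightarrow> integrable N (\<lambda>x. exp (t * x))"
    and eq: "\<And>t. t \<in> \<rat> \<Longrightarrow> (LINT x|M. exp (t * x)) = (LINT x|N. exp (t * x))"
  shows "M = N"
proof -
  interpret M: real_distribution M by fact
  interpret N: real_distribution N by fact
  let ?a = "\<lambda>k. complex_of_real ((LINT x|M. x ^ k) / fact k) - complex_of_real ((LINT x|N. x ^ k) / fact k)"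
  let ?f = "\<lambda>z. (CLINT x|M. exp (z * of_real x)) - (CLINT x|N. exp (z * of_real x))"
  note sM = mgf_power_series[OF M.events_eq_borel integrable_exp_rat_imp_real[OF M.events_eq_borel intM]]
  note sN = mgf_power_series[OF N.events_eq_borel integrable_exp_rat_imp_real[OF N.events_eq_borel intN]]
  have sums: "(\<lambda>k. ?a k * z ^ k) sums ?f z" for z
    using sums_diff[OF sM sN, of z] by (simp add: algebra_simps)
  have f0: "?f (of_real t) = 0" if "t \<in> \<rat>" for t
  proof -
    have "(\<lambda>x. exp (complex_of_real t * of_real x)) = (\<lambda>x. complex_of_real (exp (t * x)))"
      by (simp flip: of_real_mult exp_of_real)
    then show ?thesis
      using eq[OF that] by (simp del: of_real_exp)
  qed
  have "?a m = 0" if m: "m > 0" for m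
  proof (rule ccontr)
    assume am: "?a m \<noteq> 0"
    have shifted: "(\<lambda>k. ?a k * (z - 0) ^ k) sums ?f z" for z
      using sums[of z] by simp
    have "?f 0 = 0"
      using f0[of 0] by simp
    \<comment> \<open>A power series with a nonzero coefficient of positive index that vanishes at 0
      has no other zero in some disc. The zeros at 1/(k+1) contradict this for large k.\<close>
    then obtain s where s: "0 < s" "\<And>z. z \<in> cball 0 s - {0} \<Longrightarrow> ?f z \<noteq> 0"
      using am m by (rule powser_0_nonzero[OF zero_less_one shifted]) (blast intro: that)
    obtain k where k: "inverse (of_nat (Suc k)) < s"
      using reals_Archimedean[OF s(1)] by blast
    have "?f (of_real (inverse (of_nat (Suc k)))) = 0"
      by (rule f0) simp
    moreover have "complex_of_real (inverse (of_nat (Suc k))) \<in> cball 0 s - {0}"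
      using k by (auto simp: norm_inverse simp del: of_nat_Suc)
    ultimately show False
      using s(2) by blast
  qed
  \<comment> \<open>The argument above only treats positive indices; the zeroth moments agree
    because both total masses are 1.\<close>
  moreover have "?a 0 = 0"
    using M.prob_space N.prob_space by simp
  ultimately have "?a = (\<lambda>_. 0)"
    by (metis gr0I)
  then have "?f z = 0" for z
    using sums[of z] by (simp add: fun_eq_iff sums_iff)
  \<comment> \<open>The characteristic function is the same transform on the imaginary axis.\<close>
  then have "char M t = char N t" for t
    by (simp add: char_def of_real_mult mult.assoc[symmetric])
  then have "char M = char N"
    by (rule ext)
  then show ?thesis
    using M N by (intro Levy_uniqueness)
qed

section \<open>Gaussian laws and their moment generating functions\<close>

lemma real_distribution_gaussian:
  assumes "0 \<le> V"
  shows "real_distribution (gaussian \<mu> V)"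
proof (cases "V = 0")
  case True
  then show ?thesis
    by (auto simp: gaussian_def real_distribution_def real_distribution_axioms_def prob_space_return)
next
  case False
  then show ?thesis
    using assms prob_space_normal_density[of "sqrt V" \<mu>]
    by (auto simp: gaussian_def real_distribution_def real_distribution_axioms_def)
qed

lemma gaussian_mgf:
  assumes V: "0 \<le> V"
  shows "integrable (gaussian 0 V) (\<lambda>x. exp (t * x))"
    and "(LINT x|gaussian 0 V. exp (t * x)) = exp (t\<^sup>2 * V / 2)"
proof -
  have "integrable (gaussian 0 V) (\<lambda>x. exp (t * x)) \<and>
    (LINT x|gaussian 0 V. exp (t * x)) = exp (t\<^sup>2 * V / 2)"
  proof (cases "V = 0")
    case True
    then show ?thesis
      by (auto simp: gaussian_def integral_return integrable_iff_bounded nn_integral_return)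
  next
    case False
    then have pos: "0 < V" using V by simp
    \<comment> \<open>Completing the square: tilting N(0, V) by \<open>exp (t * x)\<close> moves the
      mean to \<open>t * V\<close> and leaves the variance unchanged, so the constant factor is the
      value of the transform.\<close>
    have tilt: "normal_density 0 (sqrt V) x * exp (t * x)
        = exp (t\<^sup>2 * V / 2) * normal_density (t * V) (sqrt V) x" for x
    proof -
      have "- (x - 0)\<^sup>2 / (2 * (sqrt V)\<^sup>2) + t * x = t\<^sup>2 * V / 2 + (- (x - t * V)\<^sup>2 / (2 * (sqrt V)\<^sup>2))"
        using pos by (simp add: field_simps power2_eq_square)
      then have "exp (- (x - 0)\<^sup>2 / (2 * (sqrt V)\<^sup>2)) * exp (t * x)
          = exp (t\<^sup>2 * V / 2) * exp (- (x - t * V)\<^sup>2 / (2 * (sqrt V)\<^sup>2))"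
        by (simp add: exp_add[symmetric])
      then show ?thesis
        unfolding normal_density_def by (simp add: algebra_simps)
    qed
    show ?thesis
      using False pos
      by (simp add: gaussian_def integrable_real_density integral_real_density tilt
          integral_normal_density)
  qed
  then show "integrable (gaussian 0 V) (\<lambda>x. exp (t * x))"
    and "(LINT x|gaussian 0 V. exp (t * x)) = exp (t\<^sup>2 * V / 2)" by auto
qed

section \<open>Tightness and the continuity theorem for moment generating functions\<close>

lemma tight_of_bounded_mgf:
  fixes \<mu> :: "nat \<Rightarrow> real measure"
  assumes \<mu>: "\<And>n. real_distribution (\<mu> n)"
    and int: "\<And>n. integrable (\<mu> n) (\<lambda>x. exp x)" "\<And>n. integrable (\<mu> n) (\<lambda>x. exp (- x))"
    and bnd: "\<And>n. (LINT x|\<mu> n. exp x) \<le> C" "\<And>n. (LINT x|\<mu> n. exp (- x)) \<le> C"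
  shows "tight \<mu>"
  unfolding tight_def
proof (intro conjI allI impI \<mu>)
  fix \<epsilon> :: real assume \<epsilon>: "0 < \<epsilon>"
  have "0 \<le> (LINT x|\<mu> 0. exp x)"
    by (intro integral_nonneg_AE) auto
  then have C: "0 \<le> C"
    using bnd(1)[of 0] by linarith
  \<comment> \<open>The inner 1 keeps the logarithm nonnegative; the outer 1 makes \<open>a\<close>
    positive and \<open>2 * C / \<epsilon> < exp a\<close> strict.\<close>
  define a where "a = ln (2 * C / \<epsilon> + 1) + 1"
  have a: "0 < a" "2 * C / \<epsilon> < exp a"
  proof -
    have "0 \<le> ln (2 * C / \<epsilon> + 1)"
      using C \<epsilon> by simp
    then show "0 < a" by (simp add: a_def)
    have "2 * C / \<epsilon> + 1 = exp (ln (2 * C / \<epsilon> + 1))"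
      using C \<epsilon> by (intro exp_ln[symmetric]) (auto intro: add_nonneg_pos)
    also have "\<dots> < exp a" by (simp add: a_def)
    finally show "2 * C / \<epsilon> < exp a" by simp
  qed
  have "1 - \<epsilon> < measure (\<mu> n) {- a<..a}" for n
  proof -
    interpret real_distribution "\<mu> n" by (rule \<mu>)
    have "measure (\<mu> n) (- {- a<..a}) * exp a = (LINT x|\<mu> n. exp a * indicator (- {- a<..a}) x)"
      by simp
    \<comment> \<open>Markov's inequality for both tails at once: off the half-open interval, one of
      the two exponentials is at least \<open>exp a\<close>.\<close>
    also have "\<dots> \<le> (LINT x|\<mu> n. exp x + exp (- x))"
    proof (rule integral_mono)
      show "exp a * indicator (- {- a<..a}) x \<le> exp x + exp (- x)" for x
      proof (cases "x \<in> {- a<..a}")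
        case False
        then consider "a \<le> x" | "a \<le> - x" by force
        then show ?thesis
          using False by cases (auto simp: add_increasing add_increasing2)
      qed (auto simp: add_nonneg_nonneg)
      show "integrable (\<mu> n) (\<lambda>x. exp a * indicator (- {- a<..a}) x)"
        by (intro integrable_mult_right) (auto simp: emeasure_eq_measure)
    qed (use int in auto)
    also have "\<dots> \<le> 2 * C"
      using int[of n] bnd[of n] by simp
    also have "\<dots> < \<epsilon> * exp a"
      using a \<epsilon> by (simp add: field_simps)
    finally have "measure (\<mu> n) (- {- a<..a}) < \<epsilon>"
      by simp
    moreover have "measure (\<mu> n) (- {- a<..a}) = 1 - measure (\<mu> n) {- a<..a}"
      using prob_compl[of "{- a<..a}"] by (simp add: Compl_eq_Diff_UNIV)
    ultimately show ?thesis by simp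
  qed
  then show "\<exists>a b. a < b \<and> (\<forall>n. 1 - \<epsilon> < measure (\<mu> n) {a<..b})"
    using a by (intro exI[of _ "- a"] exI[of _ a]) auto
qed

text \<open>Truncating v = exp u at K loses at most v^2 / K. The truncation error is therefore
  controlled by the transform at the doubled argument.\<close>

lemma min_exp_gap:
  fixes u K :: real
  assumes "0 < K"
  shows "exp u - exp (2 * u) / K \<le> min (exp u) K"
proof (cases "exp u \<le> K")
  case False
  have "exp u * K \<le> exp u * exp u"
    using False by (intro mult_left_mono) auto
  then have "exp u \<le> exp (2 * u) / K"
    using assms by (simp add: field_simps mult_exp_exp)
  then show ?thesis using False assms by simp
qed (use assms in auto)

text \<open>The bound on the moment generating functions at \<open>2 * t\<close> makes \<open>exp (t * x)\<close> uniformly integrable.\<close>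

lemma mgf_weak_limit:
  fixes \<mu> :: "nat \<Rightarrow> real measure"
  assumes \<mu>: "\<And>n. real_distribution (\<mu> n)" and M: "real_distribution M"
    and conv: "weak_conv_m \<mu> M"
    and int: "\<And>n. integrable (\<mu> n) (\<lambda>x. exp (t * x))" "\<And>n. integrable (\<mu> n) (\<lambda>x. exp (2 * t * x))"
    and bnd: "\<And>n. (LINT x|\<mu> n. exp (2 * t * x)) \<le> C"
    and lim: "(\<lambda>n. LINT x|\<mu> n. exp (t * x)) \<longlonglongrightarrow> c"
  shows "integrable M (\<lambda>x. exp (t * x))" and "(LINT x|M. exp (t * x)) = c"
proof -
  interpret M: real_distribution M by fact
  interpret \<mu>: real_distribution "\<mu> n" for n by fact
  \<comment> \<open>These truncations are bounded and continuous, so weak convergence applies to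
    each of them; \<open>Suc K\<close> keeps the level positive.\<close>
  define g where "g K x = min (exp (t * x)) (real (Suc K))" for K x
  have [measurable]: "g K \<in> borel_measurable borel" for K
    unfolding g_def by measurable
  have g_bnd: "\<bar>g K x\<bar> \<le> real (Suc K)" "0 \<le> g K x" for K x
    by (auto simp: g_def)
  have intgM: "integrable M (g K)" for K
    by (rule M.integrable_const_bound[where B = "real (Suc K)"]) (use g_bnd in auto)
  have intg: "integrable (\<mu> n) (g K)" for K n
    by (rule \<mu>.integrable_const_bound[where B = "real (Suc K)"]) (use g_bnd in auto)
  have convg: "(\<lambda>n. LINT x|\<mu> n. g K x) \<longlonglongrightarrow> (LINT x|M. g K x)" for K
    using \<mu> M conv
    by (rule weak_conv_imp_integral_bdd_continuous_conv[where B = "real (Suc K)"])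
      (use g_bnd in \<open>auto simp: g_def intro!: continuous_intros\<close>)
  have le: "(LINT x|M. g K x) \<le> c" for K
  proof (rule LIMSEQ_le[OF convg lim], intro exI allI impI)
    show "(LINT x|\<mu> n. g K x) \<le> (LINT x|\<mu> n. exp (t * x))" for n
      by (rule integral_mono[OF intg int(1)]) (auto simp: g_def)
  qed
  \<comment> \<open>The truncation error is at most C/(K+1) uniformly in n and so survives the limit
    in n. Letting K grow then pins the truncated integrals at \<open>c\<close>, and monotone
    convergence removes the truncation.\<close>
  have ge: "c - C / real (Suc K) \<le> (LINT x|M. g K x)" for K
  proof (rule LIMSEQ_le[OF tendsto_diff[OF lim tendsto_const] convg], intro exI allI impI)
    fix n
    have "(LINT x|\<mu> n. exp (t * x)) - C / real (Suc K)
      \<le> (LINT x|\<mu> n. exp (t * x)) - (LINT x|\<mu> n. exp (2 * t * x)) / real (Suc K)"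
      using bnd[of n] by (simp add: divide_right_mono del: of_nat_Suc)
    also have "\<dots> = (LINT x|\<mu> n. exp (t * x) - exp (2 * t * x) / real (Suc K))"
      using int[of n] by (simp del: of_nat_Suc)
    also have "\<dots> \<le> (LINT x|\<mu> n. g K x)"
      using min_exp_gap[of "real (Suc K)" "t * x" for x] int[of n]
      by (intro integral_mono intg) (auto simp: g_def mult.assoc simp del: of_nat_Suc)
    finally show "(LINT x|\<mu> n. exp (t * x)) - C / real (Suc K) \<le> (LINT x|\<mu> n. g K x)" .
  qed
  have inv0: "(\<lambda>K. C / real (Suc K)) \<longlonglongrightarrow> 0"
    by (rule LIMSEQ_Suc) (rule lim_const_over_n)
  have limg: "(\<lambda>K. LINT x|M. g K x) \<longlonglongrightarrow> c"
  proof (rule tendsto_sandwich[OF _ _ _ tendsto_const])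
    show "(\<lambda>K. c - C / real (Suc K)) \<longlonglongrightarrow> c"
      using tendsto_diff[OF tendsto_const inv0, of c] by simp
  qed (use le ge in auto)
  have gx: "(\<lambda>K. g K x) \<longlonglongrightarrow> exp (t * x)" for x
  proof (rule tendsto_eventually)
    obtain N where "exp (t * x) \<le> real N"
      using real_arch_simple by blast
    then show "\<forall>\<^sub>F K in sequentially. g K x = exp (t * x)"
      unfolding g_def eventually_sequentially by (intro exI[of _ N]) auto
  qed
  have mono: "mono (\<lambda>K. g K x)" for x
    by (auto simp: mono_def g_def)
  show "integrable M (\<lambda>x. exp (t * x))"
    by (rule integrable_monotone_convergence[where f = g, OF intgM _ _ limg]) (use gx mono in auto)
  show "(LINT x|M. exp (t * x)) = c"
    by (rule integral_monotone_convergence[where f = g, OF intgM _ _ limg]) (use gx mono in auto)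
qed

lemma weak_conv_m_offset_iff: "weak_conv_m (\<lambda>n. \<mu> (n + k)) N \<longleftrightarrow> weak_conv_m \<mu> N"
  unfolding weak_conv_m_def weak_conv_def
  using LIMSEQ_ignore_initial_segment LIMSEQ_offset[where f = "\<lambda>n. cdf (\<mu> n) x" for x] by blast

text \<open>The transforms at 1 and -1 give tightness. Along any weakly convergent subsequence the
  limit law has the transform of \<open>N\<close> at every rational, hence equals \<open>N\<close>
  by \<open>mgf_uniqueness\<close>.\<close>

lemma mgf_continuity_theorem:
  fixes \<mu> :: "nat \<Rightarrow> real measure"
  assumes \<mu>: "\<And>n. real_distribution (\<mu> n)" and N: "real_distribution N"
    and int: "\<And>t. t \<in> \<rat> \<Longrightarrow> \<forall>\<^sub>F n in sequentially. integrable (\<mu> n) (\<lambda>x. exp (t * x))"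
    and intN: "\<And>t. t \<in> \<rat> \<Longrightarrow> integrable N (\<lambda>x. exp (t * x))"
    and lim: "\<And>t. t \<in> \<rat> \<Longrightarrow> (\<lambda>n. LINT x|\<mu> n. exp (t * x)) \<longlonglongrightarrow> (LINT x|N. exp (t * x))"
  shows "weak_conv_m \<mu> N"
proof -
  have bdd: "\<exists>C. \<forall>n. (LINT x|\<mu> n. exp (t * x)) \<le> C" if "t \<in> \<rat>" for t
  proof -
    have "Bseq (\<lambda>n. LINT x|\<mu> n. exp (t * x))"
      using lim[OF that] by (intro convergent_imp_Bseq convergentI)
    then show ?thesis
      unfolding Bseq_def by (metis abs_le_D1 real_norm_def)
  qed
  \<comment> \<open>Integrability is only eventual, and the tightness criterion asks for it at every
    index, so the first \<open>k\<close> laws are dropped.\<close>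
  have "\<forall>\<^sub>F n in sequentially. integrable (\<mu> n) (\<lambda>x. exp x) \<and> integrable (\<mu> n) (\<lambda>x. exp (- x))"
    using int[of 1] int[of "- 1"] by (auto simp: eventually_conj_iff)
  then obtain k where k: "\<And>n. k \<le> n \<Longrightarrow> integrable (\<mu> n) (\<lambda>x. exp x)"
      "\<And>n. k \<le> n \<Longrightarrow> integrable (\<mu> n) (\<lambda>x. exp (- x))"
    by (auto simp: eventually_sequentially)
  let ?\<mu> = "\<lambda>n. \<mu> (n + k)"
  have "weak_conv_m ?\<mu> N"
  proof (rule tight_subseq_weak_converge[OF \<mu> N])
    obtain C1 C2 where C: "\<And>n. (LINT x|\<mu> n. exp x) \<le> C1" "\<And>n. (LINT x|\<mu> n. exp (- x)) \<le> C2"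
      using bdd[of 1] bdd[of "- 1"] by auto
    show "tight ?\<mu>"
    proof (rule tight_of_bounded_mgf[OF \<mu>])
      show "(LINT x|?\<mu> n. exp x) \<le> max C1 C2" "(LINT x|?\<mu> n. exp (- x)) \<le> max C1 C2" for n
        using C[of "n + k"] by auto
    qed (use k in auto)
    fix s \<rho> assume s: "strict_mono s" "real_distribution \<rho>" "weak_conv_m (?\<mu> \<circ> s) \<rho>"
    have "integrable \<rho> (\<lambda>x. exp (t * x)) \<and> (LINT x|\<rho>. exp (t * x)) = (LINT x|N. exp (t * x))"
      if t: "t \<in> \<rat>" for t
    proof -
      obtain C where C: "\<And>n. (LINT x|\<mu> n. exp (2 * t * x)) \<le> C"
        using bdd[of "2 * t"] t by auto
      have "\<forall>\<^sub>F n in sequentially. integrable (\<mu> n) (\<lambda>x. exp (t * x)) \<and>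
          integrable (\<mu> n) (\<lambda>x. exp (2 * t * x))"
        using int[OF t] int[of "2 * t"] t by (simp add: eventually_conj_iff)
      then obtain l where l: "\<And>n. l \<le> n \<Longrightarrow> integrable (\<mu> n) (\<lambda>x. exp (t * x))"
          "\<And>n. l \<le> n \<Longrightarrow> integrable (\<mu> n) (\<lambda>x. exp (2 * t * x))"
        by (auto simp: eventually_sequentially)
      \<comment> \<open>The threshold \<open>l\<close> depends on \<open>t\<close>, so the
        subsequence is cut again for each \<open>t\<close>. Since a strictly increasing
        \<open>s\<close> satisfies \<open>m \<le> s m\<close>, starting at \<open>l\<close> places
        every index beyond the threshold for both \<open>t\<close> and \<open>2 * t\<close>.\<close>
      define u where "u n = s (n + l) + k" for n
      have u: "strict_mono u" "\<And>n. l \<le> u n"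
      proof -
        show "strict_mono u"
          using s(1) by (auto simp: strict_mono_def u_def)
        show "l \<le> u n" for n
          using seq_suble[OF s(1), of "n + l"] by (simp add: u_def)
      qed
      have conv: "weak_conv_m (\<lambda>n. \<mu> (u n)) \<rho>"
        using s(3) weak_conv_m_offset_iff[of "?\<mu> \<circ> s" l \<rho>] by (simp add: u_def o_def)
      have "(\<lambda>n. LINT x|\<mu> (u n). exp (t * x)) \<longlonglongrightarrow> (LINT x|N. exp (t * x))"
        using LIMSEQ_subseq_LIMSEQ[OF lim[OF t] u(1)] by (simp add: o_def)
      note lims = mgf_weak_limit[OF \<mu> s(2) conv l(1)[OF u(2)] l(2)[OF u(2)] C this]
      show ?thesis
        using lims by simp
    qed
    then have "\<rho> = N"
      using intN by (intro mgf_uniqueness s N) auto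
    then show "weak_conv_m (?\<mu> \<circ> s) N"
      using s by simp
  qed
  then show ?thesis
    by (simp add: weak_conv_m_offset_iff)
qed

section \<open>Bounded Lipschitz distance\<close>

lemma borel_measurable_lipschitz:
  fixes f :: "real \<Rightarrow> real"
  assumes "1-lipschitz_on UNIV f"
  shows "f \<in> borel_measurable borel"
  using lipschitz_on_continuous_on[OF assms] by (rule borel_measurable_continuous_onI)

lemma bl_dist_le:
  assumes "\<And>f :: real \<Rightarrow> real. 1-lipschitz_on UNIV f \<Longrightarrow> (\<And>x. \<bar>f x\<bar> \<le> 1) \<Longrightarrow>
    \<bar>(LINT x|Q. f x) - (LINT x|Q'. f x)\<bar> \<le> c"
  shows "bl_dist Q Q' \<le> c"
  unfolding bl_dist_def
proof (rule cSUP_least)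
  have "1-lipschitz_on UNIV (\<lambda>_ :: real. 0 :: real)"
    by (simp add: lipschitz_on_def)
  then show "{f :: real \<Rightarrow> real. 1-lipschitz_on UNIV f \<and> (\<forall>x. \<bar>f x\<bar> \<le> 1)} \<noteq> {}"
    by auto
qed (use assms in auto)

text \<open>A supremum of reals bounds its members only when the set is bounded above. Here 2 is a
  bound, because test functions have modulus at most 1 and both laws have mass 1.\<close>

lemma integral_diff_le_bl_dist:
  fixes f :: "real \<Rightarrow> real"
  assumes Q: "real_distribution Q" and Q': "real_distribution Q'"
    and f: "1-lipschitz_on UNIV f" "\<And>x. \<bar>f x\<bar> \<le> 1"
  shows "\<bar>(LINT x|Q. f x) - (LINT x|Q'. f x)\<bar> \<le> bl_dist Q Q'"
  unfolding bl_dist_def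
proof (rule cSUP_upper[of f])
  interpret Q: real_distribution Q by fact
  interpret Q': real_distribution Q' by fact
  show "bdd_above ((\<lambda>f. \<bar>(LINT x|Q. f x) - (LINT x|Q'. f x)\<bar>) `
      {f :: real \<Rightarrow> real. 1-lipschitz_on UNIV f \<and> (\<forall>x. \<bar>f x\<bar> \<le> 1)})"
  proof (rule bdd_aboveI2[where M = 2])
    fix g :: "real \<Rightarrow> real" assume "g \<in> {f. 1-lipschitz_on UNIV f \<and> (\<forall>x. \<bar>f x\<bar> \<le> 1)}"
    then have g: "g \<in> borel_measurable borel" "\<And>x. \<bar>g x\<bar> \<le> 1"
      by (auto intro: borel_measurable_lipschitz)
    have "\<bar>LINT x|Q. g x\<bar> \<le> 1"
      using Q.integrable_const_bound[of g 1] g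
      by (intro order.trans[OF integral_abs_bound] Q.integral_le_const) auto
    moreover have "\<bar>LINT x|Q'. g x\<bar> \<le> 1"
      using Q'.integrable_const_bound[of g 1] g
      by (intro order.trans[OF integral_abs_bound] Q'.integral_le_const) auto
    ultimately show "\<bar>(LINT x|Q. g x) - (LINT x|Q'. g x)\<bar> \<le> 2" by simp
  qed
qed (use f in auto)

text \<open>Skorohod's theorem realises the laws on one space with pointwise convergence. Every
  admissible test function then changes by at most
  \<open>min \<bar>Y_seq n \<omega> - Y \<omega>\<bar> 2\<close>, a bound free of the test function
  whose mean vanishes by dominated convergence.\<close>

lemma weak_conv_imp_bl_dist:
  fixes \<mu> :: "nat \<Rightarrow> real measure"
  assumes \<mu>: "\<And>n. real_distribution (\<mu> n)" and N: "real_distribution N"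
    and conv: "weak_conv_m \<mu> N" and \<epsilon>: "0 < \<epsilon>"
  shows "\<forall>\<^sub>F n in sequentially. bl_dist (\<mu> n) N < \<epsilon>"
proof -
  obtain \<Omega> :: "real measure" and Y_seq Y where \<Omega>: "prob_space \<Omega>"
      and Y_seq[measurable]: "\<And>n. Y_seq n \<in> borel_measurable \<Omega>"
      and dist: "\<And>n. distr \<Omega> borel (Y_seq n) = \<mu> n"
      and Y0: "Y \<in> measurable \<Omega> lborel" and distY: "distr \<Omega> borel Y = N"
      and ptw: "\<And>x. x \<in> space \<Omega> \<Longrightarrow> (\<lambda>n. Y_seq n x) \<longlonglongrightarrow> Y x"
    using Skorohod[OF \<mu> N conv] by blast
  have [measurable]: "Y \<in> borel_measurable \<Omega>"
    using Y0 by simp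
  interpret prob_space \<Omega> by fact
  let ?D = "\<lambda>n \<omega>. min \<bar>Y_seq n \<omega> - Y \<omega>\<bar> 2"
  have "(\<lambda>n. LINT \<omega>|\<Omega>. ?D n \<omega>) \<longlonglongrightarrow> (LINT \<omega>|\<Omega>. 0)"
  proof (rule integral_dominated_convergence[where w = "\<lambda>_. 2"])
    show "AE \<omega> in \<Omega>. (\<lambda>n. ?D n \<omega>) \<longlonglongrightarrow> 0"
    proof (rule AE_I2)
      fix \<omega> assume "\<omega> \<in> space \<Omega>"
      then have "(\<lambda>n. ?D n \<omega>) \<longlonglongrightarrow> min \<bar>Y \<omega> - Y \<omega>\<bar> 2"
        by (intro tendsto_intros ptw)
      then show "(\<lambda>n. ?D n \<omega>) \<longlonglongrightarrow> 0" by simp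
    qed
  qed auto
  then have "\<forall>\<^sub>F n in sequentially. (LINT \<omega>|\<Omega>. ?D n \<omega>) < \<epsilon>"
    using \<epsilon> by (simp add: order_tendstoD)
  then show ?thesis
  proof eventually_elim
    case (elim n)
    have "bl_dist (\<mu> n) N \<le> (LINT \<omega>|\<Omega>. ?D n \<omega>)"
    proof (rule bl_dist_le)
      fix f :: "real \<Rightarrow> real" assume f: "1-lipschitz_on UNIV f" "\<And>x. \<bar>f x\<bar> \<le> 1"
      note [measurable] = borel_measurable_lipschitz[OF f(1)]
      have int: "integrable \<Omega> (\<lambda>\<omega>. f (Z \<omega>))" if [measurable]: "Z \<in> borel_measurable \<Omega>" for Z
        using f(2) by (intro integrable_const_bound[of _ 1]) auto
      have "(LINT x|\<mu> n. f x) - (LINT x|N. f x) = (LINT \<omega>|\<Omega>. f (Y_seq n \<omega>) - f (Y \<omega>))"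
        using int by (simp add: dist[symmetric] distY[symmetric] integral_distr)
      also have "\<bar>\<dots>\<bar> \<le> (LINT \<omega>|\<Omega>. \<bar>f (Y_seq n \<omega>) - f (Y \<omega>)\<bar>)"
        by (rule integral_abs_bound)
      also have "\<dots> \<le> (LINT \<omega>|\<Omega>. ?D n \<omega>)"
      proof (rule integral_mono)
        show "\<bar>f (Y_seq n \<omega>) - f (Y \<omega>)\<bar> \<le> ?D n \<omega>" for \<omega>
          using lipschitz_onD[OF f(1), of "Y_seq n \<omega>" "Y \<omega>"] f(2)[of "Y_seq n \<omega>"] f(2)[of "Y \<omega>"]
          by (auto simp: dist_real_def)
        show "integrable \<Omega> (?D n)"
          by (intro integrable_const_bound[of _ 2]) auto
      qed (use int in auto)
      finally show "\<bar>(LINT x|\<mu> n. f x) - (LINT x|N. f x)\<bar> \<le> (LINT \<omega>|\<Omega>. ?D n \<omega>)" .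
    qed
    then show ?case using elim by simp
  qed
qed

text \<open>This uniform version of the continuity theorem for moment generating functions replaces a
  subsequence argument, which is not available because the data live on different probability
  spaces.\<close>

lemma bl_dist_of_finitely_many_mgf:
  assumes N: "real_distribution N"
    and intN: "\<And>t. t \<in> \<rat> \<Longrightarrow> integrable N (\<lambda>x. exp (t * x))"
    and \<epsilon>: "0 < \<epsilon>"
  obtains T :: "real set" and \<kappa> :: real where "finite T" "0 < \<kappa>"
    "\<And>Q. real_distribution Q \<Longrightarrow>
      (\<And>t. t \<in> T \<Longrightarrow> \<exists>m\<ge>0. (\<integral>\<^sup>+x. ennreal (exp (t * x)) \<partial>Q) = ennreal m \<and>
        \<bar>m - (LINT x|N. exp (t * x))\<bar> < \<kappa>) \<Longrightarrow> bl_dist Q N < \<epsilon>"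
proof (rule ccontr)
  assume "\<not> thesis"
  note contr = this and wit = that
  define q :: "nat \<Rightarrow> real" where "q = from_nat_into \<rat>"
  \<comment> \<open>Stating closeness through the nonnegative integral makes a finite value
    \<open>m\<close> carry integrability as well.\<close>
  define close where "close \<kappa> Q t \<longleftrightarrow> (\<exists>m\<ge>0. (\<integral>\<^sup>+x. ennreal (exp (t * x)) \<partial>Q) = ennreal m \<and>
        \<bar>m - (LINT x|N. exp (t * x))\<bar> < \<kappa>)" for \<kappa> and Q :: "real measure" and t :: real
  \<comment> \<open>If no finite test set works, the first \<open>k + 1\<close> rationals with
    tolerance 1/(k+1) fail as well. The resulting counterexamples form a sequence whose transforms
    converge at every rational, yet which stays \<open>\<epsilon>\<close> away from
    \<open>N\<close>.\<close>
  have "\<exists>Q. real_distribution Q \<and> (\<forall>j\<le>k. close (1 / Suc k) Q (q j)) \<and> \<epsilon> \<le> bl_dist Q N" for k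
  proof (rule ccontr)
    assume "\<nexists>Q. real_distribution Q \<and> (\<forall>j\<le>k. close (1 / Suc k) Q (q j)) \<and> \<epsilon> \<le> bl_dist Q N"
    then show False
      using contr wit[of "q ` {..k}" "1 / Suc k"] unfolding close_def by force
  qed
  then obtain Q where Q: "\<And>k. real_distribution (Q k)"
      and cl: "\<And>k j. j \<le> k \<Longrightarrow> close (1 / Suc k) (Q k) (q j)"
      and far: "\<And>k. \<epsilon> \<le> bl_dist (Q k) N"
    by metis
  have mgf: "integrable (Q k) (\<lambda>x. exp (q j * x)) \<and>
      \<bar>(LINT x|Q k. exp (q j * x)) - (LINT x|N. exp (q j * x))\<bar> < 1 / Suc k" if jk: "j \<le> k" for j k
  proof -
    interpret real_distribution "Q k" by (rule Q)
    obtain m where "0 \<le> m" "(\<integral>\<^sup>+x. ennreal (exp (q j * x)) \<partial>Q k) = ennreal m"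
        and m: "\<bar>m - (LINT x|N. exp (q j * x))\<bar> < 1 / Suc k"
      using cl[OF jk] unfolding close_def by blast
    then have "integrable (Q k) (\<lambda>x. exp (q j * x)) \<and> (LINT x|Q k. exp (q j * x)) = m"
      by (subst nn_integral_eq_integrable[symmetric]) auto
    then show ?thesis using m by simp
  qed
  have range_q: "\<exists>j. q j = t" if "t \<in> \<rat>" for t
    using from_nat_into_surj[OF countable_rat that] by (auto simp: q_def)
  have q: "\<forall>\<^sub>F k in sequentially. integrable (Q k) (\<lambda>x. exp (t * x)) \<and>
      norm ((LINT x|Q k. exp (t * x)) - (LINT x|N. exp (t * x))) \<le> 1 / Suc k" if t: "t \<in> \<rat>" for t
  proof -
    obtain j where "q j = t"
      using range_q[OF t] by blast
    then show ?thesis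
      using mgf[of j] unfolding eventually_sequentially
      by (intro exI[of _ j]) (auto intro: less_imp_le simp del: of_nat_Suc)
  qed
  have conv: "weak_conv_m Q N"
  proof (rule mgf_continuity_theorem[OF Q N _ intN])
    fix t :: real assume t: "t \<in> \<rat>"
    show "\<forall>\<^sub>F k in sequentially. integrable (Q k) (\<lambda>x. exp (t * x))"
      using q[OF t] by eventually_elim simp
    have "\<forall>\<^sub>F k in sequentially. norm ((LINT x|Q k. exp (t * x)) - (LINT x|N. exp (t * x))) \<le> 1 / Suc k"
      using q[OF t] by eventually_elim simp
    then have "(\<lambda>k. (LINT x|Q k. exp (t * x)) - (LINT x|N. exp (t * x))) \<longlonglongrightarrow> 0"
      by (rule Lim_null_comparison) (rule LIMSEQ_Suc, rule lim_1_over_n)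
    then show "(\<lambda>k. LINT x|Q k. exp (t * x)) \<longlonglongrightarrow> (LINT x|N. exp (t * x))"
      by (rule LIM_zero_cancel)
  qed
  show False
    using eventually_happens[OF weak_conv_imp_bl_dist[OF Q N conv \<epsilon>]] far
    by (auto simp: not_less[symmetric])
qed

lemma bl_dist_nonneg:
  assumes "real_distribution Q" "real_distribution Q'"
  shows "0 \<le> bl_dist Q Q'"
  using integral_diff_le_bl_dist[OF assms, of "\<lambda>_. 0"] by (simp add: lipschitz_on_def)

section \<open>Conditioning on a set of large mass\<close>

lemma integral_uniform_measure:
  fixes f :: "'a \<Rightarrow> real"
  assumes [measurable]: "A \<in> sets M" "f \<in> borel_measurable M" and pos: "0 < measure M A"
  shows "(LINT x|uniform_measure M A. f x) = (LINT x|M. indicator A x * f x) / measure M A"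
proof -
  \<comment> \<open>\<open>measure\<close> sends infinite mass to 0, so positivity already forces
    finite mass.\<close>
  have em: "emeasure M A = ennreal (measure M A)"
    using pos by (metis emeasure_eq_ennreal_measure less_irrefl measure_zero_top)
  have "uniform_measure M A = density M (\<lambda>x. ennreal (indicator A x / measure M A))"
    unfolding uniform_measure_def em
    using pos by (intro density_cong) (auto simp: indicator_def ennreal_1[symmetric] divide_ennreal simp del: ennreal_1)
  then show ?thesis
    using pos by (simp add: integral_real_density)
qed

text \<open>With m the mass of \<open>A\<close>, the full integral is m times the conditional one
  plus the integral over the complement. Their difference consists of two terms, each at most 1 - m
  for test functions of modulus at most 1.\<close>

lemma bl_dist_condition:
  assumes M: "prob_space M" and [measurable]: "A \<in> sets M" "g \<in> borel_measurable M"
    and pos: "0 < measure M A" and N: "real_distribution N"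
  shows "bl_dist (distr M borel g) N
    \<le> bl_dist (distr (uniform_measure M A) borel g) N + 2 * (1 - measure M A)"
proof (rule bl_dist_le)
  interpret prob_space M by fact
  let ?U = "uniform_measure M A"
  have U: "prob_space ?U"
    using pos by (intro prob_space_uniform_measure) (auto simp: emeasure_eq_measure)
  interpret U: prob_space ?U by (rule U)
  have Q: "real_distribution (distr ?U borel g)"
    by (auto simp: real_distribution_def real_distribution_axioms_def intro: U.prob_space_distr)
  fix f :: "real \<Rightarrow> real" assume f: "1-lipschitz_on UNIV f" "\<And>x. \<bar>f x\<bar> \<le> 1"
  note [measurable] = borel_measurable_lipschitz[OF f(1)]
  let ?F = "\<lambda>x. f (g x)"
  let ?m = "measure M A"
  have intF: "integrable M ?F"
    using f(2) by (intro integrable_const_bound[of _ 1]) auto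
  have intFU: "integrable ?U ?F"
    using f(2) by (intro U.integrable_const_bound[of _ 1]) auto
  have UF: "\<bar>LINT x|?U. ?F x\<bar> \<le> 1"
    using f(2) intFU by (intro order.trans[OF integral_abs_bound] U.integral_le_const) auto
  have int2: "integrable M (\<lambda>x. indicator A x * ?F x)" "integrable M (\<lambda>x. indicator (space M - A) x * ?F x)"
    using f(2) by (intro integrable_const_bound[of _ 1]; auto simp: indicator_def)+
  have "(LINT x|M. ?F x) = (LINT x|M. indicator A x * ?F x + indicator (space M - A) x * ?F x)"
    by (intro Bochner_Integration.integral_cong) (auto simp: indicator_def)
  also have "\<dots> = ?m * (LINT x|?U. ?F x) + (LINT x|M. indicator (space M - A) x * ?F x)"
    using int2 pos by (simp add: integral_uniform_measure)
  finally have split: "(LINT x|M. ?F x) - (LINT x|?U. ?F x)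
      = (LINT x|M. indicator (space M - A) x * ?F x) - (1 - ?m) * (LINT x|?U. ?F x)"
    by (simp add: algebra_simps)
  have "\<bar>LINT x|M. indicator (space M - A) x * ?F x\<bar> \<le> (LINT x|M. \<bar>indicator (space M - A) x * ?F x\<bar>)"
    by (rule integral_abs_bound)
  also have "\<dots> \<le> (LINT x|M. indicator (space M - A) x)"
  proof (rule integral_mono)
    show "integrable M (\<lambda>x. \<bar>indicator (space M - A) x * ?F x\<bar>)"
      using int2(2) by (rule integrable_abs)
    show "integrable M (indicator (space M - A) :: _ \<Rightarrow> real)"
      by (intro integrable_const_bound[of _ 1]) (auto simp: indicator_def)
  qed (use f(2) in \<open>auto simp: indicator_def\<close>)
  also have "\<dots> = 1 - ?m"
    by (simp add: prob_compl)
  finally have 1: "\<bar>LINT x|M. indicator (space M - A) x * ?F x\<bar> \<le> 1 - ?m" .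
  have "\<bar>(1 - ?m) * (LINT x|?U. ?F x)\<bar> \<le> (1 - ?m) * 1"
    unfolding abs_mult using UF by (intro mult_mono) auto
  then have "\<bar>(LINT x|M. ?F x) - (LINT x|?U. ?F x)\<bar> \<le> 2 * (1 - ?m)"
    unfolding split using 1 by (intro order.trans[OF abs_triangle_ineq4]) simp
  moreover have "\<bar>(LINT x|distr ?U borel g. f x) - (LINT x|N. f x)\<bar> \<le> bl_dist (distr ?U borel g) N"
    by (rule integral_diff_le_bl_dist[OF Q N f])
  ultimately show "\<bar>(LINT x|distr M borel g. f x) - (LINT x|N. f x)\<bar>
      \<le> bl_dist (distr ?U borel g) N + 2 * (1 - ?m)"
    by (simp add: integral_distr)
qed

text \<open>This identifies the restricted expectations of the expansion with the moment generating
  function of the conditioned law, to which the finite criterion applies.\<close>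

lemma nn_integral_distr_uniform_measure:
  assumes [measurable]: "A \<in> sets M" "g \<in> borel_measurable M"
  shows "(\<integral>\<^sup>+x. ennreal (exp (t * x)) \<partial>distr (uniform_measure M A) borel g)
    = restricted_expectation M A (\<lambda>x. exp (t * g x))"
  by (simp add: nn_integral_distr nn_integral_uniform_measure restricted_expectation_def)

section \<open>Convergence in outer probability\<close>

text \<open>Both sets have measurable covers attaining their outer measures, and ordinary
  subadditivity applies to the covers.\<close>

lemma outer_measure_of_Un:
  assumes "A \<subseteq> space M" "B \<subseteq> space M"
  shows "outer_measure_of M (A \<union> B) \<le> outer_measure_of M A + outer_measure_of M B"
proof -
  obtain E F where E: "E \<in> sets M" "A \<subseteq> E" "outer_measure_of M A = emeasure M E"
      and F: "F \<in> sets M" "B \<subseteq> F" "outer_measure_of M B = emeasure M F"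
    using outer_measure_of_attain[OF assms(1)] outer_measure_of_attain[OF assms(2)] by auto
  have "outer_measure_of M (A \<union> B) \<le> outer_measure_of M (E \<union> F)"
    using E F by (intro outer_measure_of_mono) auto
  also have "\<dots> \<le> emeasure M E + emeasure M F"
    using E F by (simp add: emeasure_subadditive)
  finally show ?thesis using E F by simp
qed

lemma with_prob_tending_to_1_mono:
  assumes E: "with_prob_tending_to_1 P E"
    and imp: "\<forall>\<^sub>F n in sequentially. \<forall>y\<in>space (P n). E n y \<longrightarrow> F n y"
  shows "with_prob_tending_to_1 P F"
  unfolding with_prob_tending_to_1_def
proof (rule tendsto_sandwich[OF _ _ tendsto_const E[unfolded with_prob_tending_to_1_def]])
  show "\<forall>\<^sub>F n in sequentially. outer_measure_of (P n) {y \<in> space (P n). \<not> F n y}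
      \<le> outer_measure_of (P n) {y \<in> space (P n). \<not> E n y}"
    using imp by eventually_elim (intro outer_measure_of_mono, auto)
qed simp

lemma with_prob_tending_to_1_conj:
  assumes "with_prob_tending_to_1 P E" "with_prob_tending_to_1 P F"
  shows "with_prob_tending_to_1 P (\<lambda>n y. E n y \<and> F n y)"
  unfolding with_prob_tending_to_1_def
proof (rule tendsto_sandwich[OF _ _ tendsto_const])
  have "{y \<in> space (P n). \<not> (E n y \<and> F n y)}
      = {y \<in> space (P n). \<not> E n y} \<union> {y \<in> space (P n). \<not> F n y}" for n
    by auto
  then show "\<forall>\<^sub>F n in sequentially. outer_measure_of (P n) {y \<in> space (P n). \<not> (E n y \<and> F n y)}
      \<le> outer_measure_of (P n) {y \<in> space (P n). \<not> E n y}
        + outer_measure_of (P n) {y \<in> space (P n). \<not> F n y}"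
    by (auto intro!: always_eventually outer_measure_of_Un)
  show "(\<lambda>n. outer_measure_of (P n) {y \<in> space (P n). \<not> E n y}
        + outer_measure_of (P n) {y \<in> space (P n). \<not> F n y}) \<longlonglongrightarrow> 0"
    using tendsto_add[OF assms[unfolded with_prob_tending_to_1_def]] by simp
qed simp

lemma with_prob_tending_to_1_finite_ball:
  assumes "finite T" "\<And>t. t \<in> T \<Longrightarrow> with_prob_tending_to_1 P (E t)"
  shows "with_prob_tending_to_1 P (\<lambda>n y. \<forall>t\<in>T. E t n y)"
  using assms
proof (induction T)
  case empty
  have "outer_measure_of (P n) {} = 0" for n
    by simp
  then show ?case
    by (simp add: with_prob_tending_to_1_def)
next
  case (insert t T)
  then show ?case
    using with_prob_tending_to_1_conj[of P "E t" "\<lambda>n y. \<forall>t\<in>T. E t n y"] by simp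
qed

lemma with_prob_tending_to_1_AE:
  assumes "\<And>n. AE y in P n. E n y"
  shows "with_prob_tending_to_1 P E"
proof -
  have "outer_measure_of (P n) {y \<in> space (P n). \<not> E n y} = 0" for n
  proof -
    obtain N where N: "{y \<in> space (P n). \<not> E n y} \<subseteq> N" "emeasure (P n) N = 0" "N \<in> sets (P n)"
      using AE_E[OF assms] by metis
    then have "outer_measure_of (P n) {y \<in> space (P n). \<not> E n y} \<le> emeasure (P n) N"
      using outer_measure_of_mono[OF N(1), of "P n"] by simp
    then show ?thesis using N by simp
  qed
  then show ?thesis
    by (simp add: with_prob_tending_to_1_def)
qed

lemma oP_iff_with_prob_tending_to_1:
  "oP P X \<longleftrightarrow> (\<forall>\<epsilon>>0. with_prob_tending_to_1 P (\<lambda>n y. \<bar>X n y\<bar> \<le> ereal \<epsilon>))"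
  by (simp add: oP_def with_prob_tending_to_1_def not_le)

section \<open>Change of parameter in the fractional posterior\<close>

text \<open>Both log-likelihoods are finite offsets of the same \<open>l\<close>. For finite
  \<open>l\<close> this is arithmetic of exponents; for \<open>l\<close> equal to minus infinity
  both likelihoods vanish.\<close>

lemma frac_lik_loglik_shift:
  assumes "0 < \<alpha>" and "loglik p \<eta> y = l + ereal a" "loglik p \<eta>' y = l + ereal b" and "l \<noteq> \<infinity>"
  shows "ennreal (exp u) * frac_lik \<alpha> p \<eta> y
    = ennreal (exp (u + \<alpha> * (a - b))) * frac_lik \<alpha> p \<eta>' y"
proof (cases l)
  case (real x)
  have "exp u * exp (\<alpha> * (x + a)) = exp (u + \<alpha> * (a - b)) * exp (\<alpha> * (x + b))"
    by (simp add: mult_exp_exp algebra_simps)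
  then show ?thesis
    using assms real by (simp add: frac_lik_def exp_ext_def ennreal_mult'[symmetric])
qed (use assms in \<open>auto simp: frac_lik_def exp_ext_def\<close>)

text \<open>For \<open>J\<close> positive and finite, \<open>d\<close> is ln(I/J) - c. If
  \<open>J\<close> is 0 or infinite, the two bounds force \<open>I = J\<close> and
  \<open>d = 0\<close> serves.\<close>

lemma ennreal_between_exp_multiples:
  fixes I J :: ennreal
  assumes "ennreal (exp (c - \<epsilon>)) * J \<le> I" "I \<le> ennreal (exp (c + \<epsilon>)) * J" "0 \<le> \<epsilon>"
  obtains d where "\<bar>d\<bar> \<le> \<epsilon>" "I = ennreal (exp (c + d)) * J"
proof (cases "J = 0 \<or> J = \<top>")
  case True
  then have "I = ennreal (exp (c + 0)) * J"
    using assms by (auto simp: ennreal_mult_top top_unique)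
  then show ?thesis using that[of 0] assms by simp
next
  case False
  then obtain j where j: "J = ennreal j" "0 < j"
    by (cases J) (auto simp: less_le)
  have "I \<noteq> \<top>"
    using assms(2) j by (auto simp: ennreal_mult'[symmetric] top_unique)
  then obtain i where i: "I = ennreal i" "0 \<le> i"
    by (cases I) auto
  have le: "exp (c - \<epsilon>) * j \<le> i" "i \<le> exp (c + \<epsilon>) * j"
    using assms(1,2) i j by (auto simp: ennreal_mult'[symmetric])
  have "0 < exp (c - \<epsilon>) * j"
    using j by simp
  then have ipos: "0 < i" using le(1) by linarith
  let ?d = "ln (i / j) - c"
  have "exp (c - \<epsilon>) \<le> exp (ln (i / j))" "exp (ln (i / j)) \<le> exp (c + \<epsilon>)"
    using le ipos j by (simp_all add: pos_le_divide_eq pos_divide_le_eq)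
  then have "c - \<epsilon> \<le> ln (i / j)" "ln (i / j) \<le> c + \<epsilon>"
    by (simp_all only: exp_le_cancel_iff)
  then have "\<bar>?d\<bar> \<le> \<epsilon>" by linarith
  moreover have "I = ennreal (exp (c + ?d)) * J"
    using ipos j i by (simp add: ennreal_mult'[symmetric])
  ultimately show ?thesis by (rule that)
qed

text \<open>The pointwise identity traps the unnormalised integral over \<open>A\<close> between
  \<open>exp (c - \<epsilon>)\<close> and \<open>exp (c + \<epsilon>)\<close> times the shifted one.
  Conditioning on \<open>A\<close> also divides by its posterior mass, which contributes the
  logarithm to the error.\<close>

lemma restricted_expectation_change_of_likelihood:
  fixes prior :: "'v measure"
  assumes A[measurable]: "A \<in> sets prior"
    and lik[measurable]: "(\<lambda>\<eta>. frac_lik \<alpha> p \<eta> y) \<in> borel_measurable prior"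
    and lik_\<tau>: "(\<lambda>\<eta>. frac_lik \<alpha> p (\<tau> \<eta>) y) \<in> borel_measurable (restrict_space prior A)"
    and G[measurable]: "G \<in> borel_measurable prior"
    and mass: "0 < measure (frac_posterior \<alpha> prior p y) A"
    and \<epsilon>: "0 \<le> \<epsilon>" "\<And>\<eta>. \<eta> \<in> A \<Longrightarrow> \<bar>d \<eta>\<bar> \<le> \<epsilon>"
    and tilt: "\<And>\<eta>. \<eta> \<in> A \<Longrightarrow> ennreal (G \<eta>) * frac_lik \<alpha> p \<eta> y
      = ennreal (exp (c + d \<eta>)) * frac_lik \<alpha> p (\<tau> \<eta>) y"
  obtains \<delta> where "\<bar>\<delta>\<bar> \<le> \<epsilon> + \<bar>ln (measure (frac_posterior \<alpha> prior p y) A)\<bar>"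
    "restricted_expectation (frac_posterior \<alpha> prior p y) A G
      = ennreal (exp (\<delta> + c)) * shifted_ratio \<alpha> prior p A \<tau> y"
proof -
  let ?post = "frac_posterior \<alpha> prior p y"
  let ?D = "\<integral>\<^sup>+\<theta>. frac_lik \<alpha> p \<theta> y \<partial>prior"
  define m where "m = measure ?post A"
  have m: "0 < m" "emeasure ?post A = ennreal m"
    using mass unfolding m_def
    by (simp, metis emeasure_eq_ennreal_measure less_irrefl measure_zero_top)
  define I where "I = (\<integral>\<^sup>+\<eta>. ennreal (G \<eta>) * frac_lik \<alpha> p \<eta> y * indicator A \<eta> \<partial>prior)"
  define J where "J = (\<integral>\<^sup>+\<eta>\<in>A. frac_lik \<alpha> p (\<tau> \<eta>) y \<partial>prior)"
  \<comment> \<open>The shifted likelihood is measurable only on \<open>A\<close>; the indicator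
    extends it by 0.\<close>
  have Jm: "(\<lambda>\<eta>. frac_lik \<alpha> p (\<tau> \<eta>) y * indicator A \<eta>) \<in> borel_measurable prior"
    using lik_\<tau> A by (simp add: borel_measurable_restrict_space_iff_ennreal)
  have lower: "ennreal (exp (c - \<epsilon>)) * J \<le> I"
  proof -
    have "ennreal (exp (c - \<epsilon>)) * J
        = (\<integral>\<^sup>+\<eta>. ennreal (exp (c - \<epsilon>)) * (frac_lik \<alpha> p (\<tau> \<eta>) y * indicator A \<eta>) \<partial>prior)"
      unfolding J_def using Jm by (rule nn_integral_cmult[symmetric])
    also have "\<dots> \<le> I"
      unfolding I_def
    proof (rule nn_integral_mono)
      fix \<eta>
      have "c - \<epsilon> \<le> c + d \<eta>" if "\<eta> \<in> A"
        using \<epsilon>(2)[OF that] by linarith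
      then show "ennreal (exp (c - \<epsilon>)) * (frac_lik \<alpha> p (\<tau> \<eta>) y * indicator A \<eta>)
          \<le> ennreal (G \<eta>) * frac_lik \<alpha> p \<eta> y * indicator A \<eta>"
        by (cases "\<eta> \<in> A") (auto simp: tilt intro!: mult_right_mono ennreal_leI)
    qed
    finally show ?thesis .
  qed
  have upper: "I \<le> ennreal (exp (c + \<epsilon>)) * J"
  proof -
    have "I \<le> (\<integral>\<^sup>+\<eta>. ennreal (exp (c + \<epsilon>)) * (frac_lik \<alpha> p (\<tau> \<eta>) y * indicator A \<eta>) \<partial>prior)"
      unfolding I_def
    proof (rule nn_integral_mono)
      fix \<eta>
      have "c + d \<eta> \<le> c + \<epsilon>" if "\<eta> \<in> A"
        using \<epsilon>(2)[OF that] by linarith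
      then show "ennreal (G \<eta>) * frac_lik \<alpha> p \<eta> y * indicator A \<eta>
          \<le> ennreal (exp (c + \<epsilon>)) * (frac_lik \<alpha> p (\<tau> \<eta>) y * indicator A \<eta>)"
        by (cases "\<eta> \<in> A") (auto simp: tilt intro!: mult_right_mono ennreal_leI)
    qed
    also have "\<dots> = ennreal (exp (c + \<epsilon>)) * J"
      unfolding J_def using Jm by (rule nn_integral_cmult)
    finally show ?thesis .
  qed
  obtain e where e: "\<bar>e\<bar> \<le> \<epsilon>" "I = ennreal (exp (c + e)) * J"
    using ennreal_between_exp_multiples[OF lower upper \<epsilon>(1)] by blast
  have "(\<integral>\<^sup>+\<eta>\<in>A. ennreal (G \<eta>) \<partial>?post)
      = (\<integral>\<^sup>+\<eta>. (ennreal (G \<eta>) * frac_lik \<alpha> p \<eta> y * indicator A \<eta>) / ?D \<partial>prior)"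
    unfolding frac_posterior_def
    by (subst nn_integral_density)
      (auto intro!: nn_integral_cong simp: divide_ennreal_def ac_simps)
  also have "\<dots> = I / ?D"
    unfolding I_def by (rule nn_integral_divide) measurable
  finally have "restricted_expectation ?post A G = ennreal (exp (c + e)) * J / ?D / ennreal m"
    by (simp add: restricted_expectation_def m e)
  also have "\<dots> = (ennreal (exp (c + e)) / ennreal m) * (J / ?D)"
    by (simp add: divide_ennreal_def ac_simps)
  \<comment> \<open>The mass of \<open>A\<close> moves into the exponent as
    \<open>- ln m\<close>.\<close>
  also have "ennreal (exp (c + e)) / ennreal m = ennreal (exp ((e - ln m) + c))"
    using m by (simp add: divide_ennreal exp_add exp_diff)
  finally have "restricted_expectation ?post A G
      = ennreal (exp ((e - ln m) + c)) * shifted_ratio \<alpha> prior p A \<tau> y"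
    by (simp add: shifted_ratio_def J_def)
  moreover have "\<bar>e - ln m\<bar> \<le> \<epsilon> + \<bar>ln m\<bar>"
    using e by linarith
  ultimately show ?thesis
    using that unfolding m_def by blast
qed

text \<open>When the normalising constant is \<open>0\<close> or \<open>\<infinity>\<close>, \<open>frac_posterior\<close> is the null measure.\<close>

lemma prob_space_frac_posterior:
  assumes [measurable]: "(\<lambda>\<eta>. frac_lik \<alpha> p \<eta> y) \<in> borel_measurable prior" "A \<in> sets prior"
    and mass: "0 < measure (frac_posterior \<alpha> prior p y) A"
  shows "prob_space (frac_posterior \<alpha> prior p y)"
proof
  let ?post = "frac_posterior \<alpha> prior p y"
  let ?D = "\<integral>\<^sup>+\<theta>. frac_lik \<alpha> p \<theta> y \<partial>prior"
  \<comment> \<open>In \<open>ennreal\<close> this quotient is 0 when \<open>?D\<close> is 0 or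
    infinite and 1 otherwise, so positive mass on \<open>A\<close> leaves only the value 1.\<close>
  have sp: "emeasure ?post (space ?post) = ?D / ?D"
    unfolding frac_posterior_def
    by (subst emeasure_density) (simp_all add: nn_integral_divide)
  have "emeasure ?post A \<noteq> 0"
    using mass by (auto simp: measure_def)
  moreover have "emeasure ?post A \<le> emeasure ?post (space ?post)"
    by (intro emeasure_space)
  ultimately have "?D / ?D \<noteq> 0"
    using sp by auto
  then have "?D \<noteq> 0" "?D \<noteq> \<top>"
    by auto
  then show "emeasure ?post (space ?post) = 1"
    by (simp add: sp ennreal_divide_self less_top)
qed

section \<open>Tolerances for logarithms and perturbed exponentials\<close>

lemma abs_ln_le_near_1:
  assumes "0 < (\<epsilon> :: real)"
  obtains \<kappa> :: real where "0 < \<kappa>" "\<And>b. \<bar>b - 1\<bar> \<le> \<kappa> \<Longrightarrow> 0 < b \<and> \<bar>ln b\<bar> \<le> \<epsilon>"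
proof -
  have "((\<lambda>b. ln b) \<longlongrightarrow> ln (1::real)) (nhds 1)"
    using tendsto_ln[OF filterlim_ident, of 1] by simp
  then have "\<forall>\<^sub>F b in nhds (1::real). \<bar>ln b\<bar> < \<epsilon>"
    using assms by (auto simp: tendsto_iff dist_real_def)
  moreover have "\<forall>\<^sub>F b in nhds (1::real). 0 < b"
    by (rule order_tendstoD[OF filterlim_ident]) simp
  ultimately have "\<forall>\<^sub>F b in nhds (1::real). 0 < b \<and> \<bar>ln b\<bar> \<le> \<epsilon>"
    by eventually_elim auto
  then obtain e where e: "0 < e" "\<And>b. \<bar>b - 1\<bar> < e \<Longrightarrow> 0 < b \<and> \<bar>ln b\<bar> \<le> \<epsilon>"
    by (auto simp: eventually_nhds_metric dist_real_def)
  then show ?thesis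
    by (intro that[of "e / 2"]) auto
qed

lemma exp_times_near:
  assumes "0 < (\<kappa> :: real)"
  obtains \<epsilon> :: real where "0 < \<epsilon>"
    "\<And>d x. \<bar>d\<bar> \<le> \<epsilon> \<Longrightarrow> \<bar>x - 1\<bar> \<le> \<epsilon> \<Longrightarrow> \<bar>exp (d + c) * x - exp c\<bar> < \<kappa>"
proof -
  have "isCont (\<lambda>z :: real \<times> real. exp (fst z + c) * snd z) (0, 1)"
    by (intro continuous_intros)
  then obtain e where e: "0 < e"
      "\<And>z. dist z (0, 1) < e \<Longrightarrow> \<bar>exp (fst z + c) * snd z - exp c\<bar> < \<kappa>"
    using assms unfolding continuous_at_eps_delta by (force simp: dist_real_def)
  show ?thesis
  proof (rule that[of "e / 3"])
    fix d x :: real assume "\<bar>d\<bar> \<le> e / 3" "\<bar>x - 1\<bar> \<le> e / 3"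
    moreover have "dist (d, x) (0, 1) \<le> \<bar>d\<bar> + \<bar>x - 1\<bar>"
      by (simp add: dist_Pair_Pair dist_real_def sqrt_sum_squares_le_sum_abs)
    ultimately have "dist (d, x) (0, 1) < e"
      using e(1) by linarith
    then show "\<bar>exp (d + c) * x - exp c\<bar> < \<kappa>"
      using e(2)[of "(d, x)"] by simp
  qed (use e in simp)
qed

section \<open>The posterior Laplace transform and its Gaussian limit\<close>

theorem theorem2p2:
  fixes S :: "'v::real_vector set"
    and \<nu> :: "nat \<Rightarrow> 'y measure"
    and P :: "nat \<Rightarrow> 'v \<Rightarrow> 'y measure"
    and p :: "nat \<Rightarrow> 'v \<Rightarrow> 'y \<Rightarrow> real"
    and prior :: "nat \<Rightarrow> 'v measure"
    and \<alpha> :: "nat \<Rightarrow> real"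
    and \<eta>\<^sub>0 :: 'v
    and \<iota> :: "'h::{real_inner, complete_space} \<Rightarrow> 'v"
    and W :: "nat \<Rightarrow> 'y \<Rightarrow> 'h \<Rightarrow> real"
    and R :: "nat \<Rightarrow> 'y \<Rightarrow> 'v \<Rightarrow> 'v \<Rightarrow> real"
    and \<psi> :: "'v \<Rightarrow> real"
    and \<psi>\<^sub>0 :: 'h
    and r :: "'v \<Rightarrow> 'v \<Rightarrow> real"
    and A :: "nat \<Rightarrow> 'v set"
  defines "P\<^sub>0 \<equiv> \<lambda>n. P n \<eta>\<^sub>0"
    and "post \<equiv> \<lambda>n. frac_posterior (\<alpha> n) (prior n) (p n)"
    and "sh \<equiv> \<lambda>n. shift \<iota> \<psi>\<^sub>0 (real n * \<alpha> n)"
    and "\<psi>hat \<equiv> \<lambda>n y. \<psi> \<eta>\<^sub>0 + W n y \<psi>\<^sub>0 / sqrt (real n)"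
    and "V\<^sub>0 \<equiv> (norm \<psi>\<^sub>0)\<^sup>2"
    and "ratio \<equiv> \<lambda>t n. shifted_ratio (\<alpha> n) (prior n) (p n) (A n) (shift \<iota> \<psi>\<^sub>0 (real n * \<alpha> n) t)"
  assumes dominated: "\<And>n. dominated_experiment S (\<nu> n) (P n) (p n)"
    and true_parameter: "\<eta>\<^sub>0 \<in> S"
    and prior_prob: "\<And>n. prob_space (prior n)" "\<And>n. space (prior n) = S"
    and lik_measurable:
      "\<And>n y. y \<in> space (\<nu> n) \<Longrightarrow> (\<lambda>\<eta>. p n \<eta> y) \<in> borel_measurable (prior n)"
    and psi_measurable: "\<And>n. \<psi> \<in> borel_measurable (prior n)"
    and alpha: "\<And>n. 0 < \<alpha> n" "\<And>n. \<alpha> n \<le> 1"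
      "filterlim (\<lambda>n. real n * \<alpha> n) at_top sequentially"
    and embedding: "linear \<iota>" "inj \<iota>"
    and LAN: "\<And>n. AE y in P\<^sub>0 n. \<forall>h. \<eta>\<^sub>0 + \<iota> h \<in> S \<longrightarrow>
      loglik (p n) (\<eta>\<^sub>0 + \<iota> h) y = loglik (p n) \<eta>\<^sub>0 y +
        ereal (- (real n / 2) * (norm h)\<^sup>2 + sqrt (real n) * W n y h + R n y (\<eta>\<^sub>0 + \<iota> h) \<eta>\<^sub>0)"
    and W_linear: "\<And>n. AE y in P\<^sub>0 n. linear (W n y)"
    and W_measurable: "\<And>n h. (\<lambda>y. W n y h) \<in> borel_measurable (P\<^sub>0 n)"
    and W_weak_limit:
      "\<And>h. weak_conv_m (\<lambda>n. distr (P\<^sub>0 n) borel (\<lambda>y. W n y h)) (gaussian 0 ((norm h)\<^sup>2))"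
    and functional_expansion:
      "\<And>h. \<eta>\<^sub>0 + \<iota> h \<in> S \<Longrightarrow> \<psi> (\<eta>\<^sub>0 + \<iota> h) - \<psi> \<eta>\<^sub>0 = inner \<psi>\<^sub>0 h + r (\<eta>\<^sub>0 + \<iota> h) \<eta>\<^sub>0"
    and A_measurable: "\<And>n. A n \<in> sets (prior n)"
    and A_mass: "oP P\<^sub>0 (\<lambda>n y. ereal (measure (post n y) (A n) - 1))"
    and A_in_H: "\<forall>\<^sub>F n in sequentially. \<forall>\<eta>\<in>A n. \<eta> - \<eta>\<^sub>0 \<in> range \<iota>"
    and shift_in_S: "\<And>t. \<forall>\<^sub>F n in sequentially. \<forall>\<eta>\<in>A n. sh n t \<eta> \<in> S"
    and shift_lik_measurable:
      "\<And>t. \<forall>\<^sub>F n in sequentially. \<forall>y\<in>space (\<nu> n).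
        (\<lambda>\<eta>. p n (sh n t \<eta>) y) \<in> borel_measurable (restrict_space (prior n) (A n))"
    and remainder: "\<And>t. oP P\<^sub>0 (\<lambda>n y. SUP \<eta>\<in>A n.
      ereal \<bar>t * sqrt (real n * \<alpha> n) * r \<eta> \<eta>\<^sub>0 + \<alpha> n * (R n y \<eta> \<eta>\<^sub>0 - R n y (sh n t \<eta>) \<eta>\<^sub>0)\<bar>)"
  shows "(\<forall>t. \<exists>\<delta> :: nat \<Rightarrow> 'y \<Rightarrow> real. oP P\<^sub>0 (\<lambda>n y. ereal (\<delta> n y)) \<and>
        with_prob_tending_to_1 P\<^sub>0 (\<lambda>n y.
          restricted_expectation (post n y) (A n)
              (\<lambda>\<eta>. exp (t * sqrt (real n * \<alpha> n) * (\<psi> \<eta> - \<psi>hat n y)))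
            = ennreal (exp (\<delta> n y + t\<^sup>2 * V\<^sub>0 / 2)) * ratio t n y))
    \<and> ((\<forall>t. oP P\<^sub>0 (\<lambda>n y. enn2ereal (ratio t n y) - 1)) \<longrightarrow>
        weak_conv_in_prob P\<^sub>0
          (\<lambda>n y. distr (post n y) borel (\<lambda>\<eta>. sqrt (real n * \<alpha> n) * (\<psi> \<eta> - \<psi>hat n y)))
          (gaussian 0 V\<^sub>0))"
proof -
  have sets_post: "sets (post n y) = sets (prior n)" for n y
    by (simp add: post_def frac_posterior_def)
  have space_P0: "space (P\<^sub>0 n) = space (\<nu> n)" for n
    using dominated[of n] true_parameter by (simp add: P\<^sub>0_def dominated_experiment_def)
  have V: "0 \<le> V\<^sub>0"
    by (simp add: V\<^sub>0_def)
  have frac_lik_meas: "(\<lambda>\<eta>. frac_lik (\<alpha> n) (p n) \<eta> y) \<in> borel_measurable (prior n)"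
    if y: "y \<in> space (\<nu> n)" for n y
  proof -
    have "frac_lik (\<alpha> n) (p n) \<eta> y = ennreal (p n \<eta> y powr \<alpha> n)" if "\<eta> \<in> space (prior n)" for \<eta>
      using that y dominated[of n] prior_prob(2)[of n] alpha(1)[of n]
      by (intro frac_lik_eq_powr) (auto simp: dominated_experiment_def)
    moreover have "(\<lambda>\<eta>. ennreal (p n \<eta> y powr \<alpha> n)) \<in> borel_measurable (prior n)"
      using lik_measurable[OF y] by measurable
    ultimately show ?thesis
      by (simp cong: measurable_cong)
  qed
  have shifted_lik_meas: "\<forall>\<^sub>F n in sequentially. \<forall>y\<in>space (\<nu> n).
      (\<lambda>\<eta>. frac_lik (\<alpha> n) (p n) (sh n t \<eta>) y) \<in> borel_measurable (restrict_space (prior n) (A n))" for t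
    using shift_lik_measurable[of t] shift_in_S[of t]
  proof eventually_elim
    case (elim n)
    show ?case
    proof
      fix y assume y: "y \<in> space (\<nu> n)"
      have "frac_lik (\<alpha> n) (p n) (sh n t \<eta>) y = ennreal (p n (sh n t \<eta>) y powr \<alpha> n)"
        if "\<eta> \<in> space (restrict_space (prior n) (A n))" for \<eta>
        using that y dominated[of n] elim(2) alpha(1)[of n]
        by (intro frac_lik_eq_powr) (auto simp: dominated_experiment_def space_restrict_space)
      moreover have "(\<lambda>\<eta>. ennreal (p n (sh n t \<eta>) y powr \<alpha> n))
          \<in> borel_measurable (restrict_space (prior n) (A n))"
      proof -
        have "(\<lambda>x. ennreal (x powr \<alpha> n)) \<in> borel_measurable borel"
          by measurable
        then show ?thesis
          using elim(1) y by (auto intro: measurable_compose[rotated])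
      qed
      ultimately show "(\<lambda>\<eta>. frac_lik (\<alpha> n) (p n) (sh n t \<eta>) y)
          \<in> borel_measurable (restrict_space (prior n) (A n))"
        by (simp cong: measurable_cong)
    qed
  qed
  define rem where "rem t n y \<eta> = t * sqrt (real n * \<alpha> n) * r \<eta> \<eta>\<^sub>0
      + \<alpha> n * (R n y \<eta> \<eta>\<^sub>0 - R n y (sh n t \<eta>) \<eta>\<^sub>0)" for t n y \<eta>
  define supr where "supr t n y = (SUP \<eta>\<in>A n. ereal \<bar>rem t n y \<eta>\<bar>)" for t n y
  define G where "G t n y \<eta> = exp (t * sqrt (real n * \<alpha> n) * (\<psi> \<eta> - \<psi>hat n y))" for t n y \<eta>
  \<comment> \<open>This event fixes the data point before the direction \<open>h\<close>, so the
    expansion can be used at \<open>h\<close> and at its shift simultaneously.\<close>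
  define lan where "lan n y \<longleftrightarrow> linear (W n y) \<and> (\<forall>h. \<eta>\<^sub>0 + \<iota> h \<in> S \<longrightarrow>
      loglik (p n) (\<eta>\<^sub>0 + \<iota> h) y = loglik (p n) \<eta>\<^sub>0 y +
        ereal (- (real n / 2) * (norm h)\<^sup>2 + sqrt (real n) * W n y h + R n y (\<eta>\<^sub>0 + \<iota> h) \<eta>\<^sub>0))" for n y
  have wp_lan: "with_prob_tending_to_1 P\<^sub>0 lan"
  proof (rule with_prob_tending_to_1_AE)
    show "AE y in P\<^sub>0 n. lan n y" for n
      using LAN[of n] W_linear[of n] unfolding lan_def by eventually_elim blast
  qed
  have wp_supr: "with_prob_tending_to_1 P\<^sub>0 (\<lambda>n y. \<bar>supr t n y\<bar> \<le> ereal \<epsilon>)" if "0 < \<epsilon>" for t \<epsilon>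
    using remainder[of t] that unfolding oP_iff_with_prob_tending_to_1 supr_def rem_def by blast
  have wp_mass: "with_prob_tending_to_1 P\<^sub>0 (\<lambda>n y. \<bar>measure (post n y) (A n) - 1\<bar> \<le> \<epsilon>)" if "0 < \<epsilon>" for \<epsilon>
    using A_mass that unfolding oP_iff_with_prob_tending_to_1 by simp
  have tilt: "ennreal (G t n y \<eta>) * frac_lik (\<alpha> n) (p n) \<eta> y
      = ennreal (exp (t\<^sup>2 * V\<^sub>0 / 2 + rem t n y \<eta>)) * frac_lik (\<alpha> n) (p n) (sh n t \<eta>) y"
    if lan: "lan n y" and n: "0 < n" and \<eta>: "\<eta> \<in> S" "\<eta> - \<eta>\<^sub>0 \<in> range \<iota>" "sh n t \<eta> \<in> S"
    for t n y \<eta>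
  proof -
    obtain h where "\<eta> - \<eta>\<^sub>0 = \<iota> h"
      using \<eta>(2) by blast
    then have h: "\<eta> = \<eta>\<^sub>0 + \<iota> h"
      by (simp add: algebra_simps)
    define s where "s = real n * \<alpha> n"
    have s: "0 < s" "0 < \<alpha> n"
      using n alpha(1)[of n] by (auto simp: s_def)
    define c where "c = t / sqrt s"
    have shh: "sh n t \<eta> = \<eta>\<^sub>0 + \<iota> (h - c *\<^sub>R \<psi>\<^sub>0)"
      using embedding(1)
      by (simp add: sh_def shift_def h c_def s_def linear_diff linear_scale)
    define a where "a = - (real n / 2) * (norm h)\<^sup>2 + sqrt (real n) * W n y h + R n y \<eta> \<eta>\<^sub>0"
    define b where "b = - (real n / 2) * (norm (h - c *\<^sub>R \<psi>\<^sub>0))\<^sup>2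
      + sqrt (real n) * W n y (h - c *\<^sub>R \<psi>\<^sub>0) + R n y (sh n t \<eta>) \<eta>\<^sub>0"
    have la: "loglik (p n) \<eta> y = loglik (p n) \<eta>\<^sub>0 y + ereal a"
      using lan \<eta>(1) unfolding lan_def a_def h by blast
    have lb: "loglik (p n) (sh n t \<eta>) y = loglik (p n) \<eta>\<^sub>0 y + ereal b"
      using lan \<eta>(3) unfolding lan_def b_def shh by blast
    have "loglik (p n) \<eta>\<^sub>0 y \<noteq> \<infinity>"
      by (simp add: loglik_def)
    note eq = frac_lik_loglik_shift[OF s(2) la lb this,
      of "t * sqrt (real n * \<alpha> n) * (\<psi> \<eta> - \<psi>hat n y)"]
    have W: "W n y (h - c *\<^sub>R \<psi>\<^sub>0) = W n y h - c * W n y \<psi>\<^sub>0"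
      using lan by (simp add: lan_def linear_diff linear_scale)
    have norm: "(norm (h - c *\<^sub>R \<psi>\<^sub>0))\<^sup>2 = (norm h)\<^sup>2 - 2 * c * inner \<psi>\<^sub>0 h + c\<^sup>2 * V\<^sub>0"
      unfolding V\<^sub>0_def power2_norm_eq_inner
      by (simp add: inner_diff_left inner_diff_right inner_commute power2_eq_square algebra_simps)
    have psi: "\<psi> \<eta> - \<psi> \<eta>\<^sub>0 = inner \<psi>\<^sub>0 h + r \<eta> \<eta>\<^sub>0"
      using functional_expansion[of h] \<eta>(1) by (simp add: h)
    have ab: "a - b = - real n * c * inner \<psi>\<^sub>0 h + real n * c\<^sup>2 * V\<^sub>0 / 2
        + sqrt (real n) * c * W n y \<psi>\<^sub>0 + (R n y \<eta> \<eta>\<^sub>0 - R n y (sh n t \<eta>) \<eta>\<^sub>0)"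
      unfolding a_def b_def W norm by (simp add: algebra_simps)
    \<comment> \<open>With \<open>s = real n * \<alpha> n\<close> and \<open>c = t / sqrt s\<close>,
      the cross term, the quadratic term and the term in \<open>W\<close> acquire the coefficients t
      sqrt s, t^2 and t sqrt s / sqrt n. The last one matches the scaling of \<open>W\<close> in
      \<open>\<psi>hat\<close>.\<close>
    have c1: "\<alpha> n * (real n * c) = t * sqrt s"
    proof -
      have "\<alpha> n * (real n * c) = s * c"
        by (simp add: s_def)
      also have "\<dots> = t * (s / sqrt s)"
        by (simp add: c_def)
      finally show ?thesis
        using s(1) by (simp add: real_div_sqrt)
    qed
    have c2: "\<alpha> n * (real n * c\<^sup>2) = t\<^sup>2"
    proof -
      have "\<alpha> n * (real n * c\<^sup>2) = s * c\<^sup>2"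
        by (simp add: s_def)
      then show ?thesis
        using s(1) by (simp add: c_def power_divide)
    qed
    have c3: "\<alpha> n * (sqrt (real n) * c) = t * sqrt s / sqrt (real n)"
    proof -
      have "\<alpha> n * (sqrt (real n) * c) = \<alpha> n * (real n * c) / sqrt (real n)"
        using n by (simp add: real_div_sqrt eq_divide_eq)
      then show ?thesis by (simp only: c1)
    qed
    have "\<alpha> n * (a - b) = - (\<alpha> n * (real n * c)) * inner \<psi>\<^sub>0 h + (\<alpha> n * (real n * c\<^sup>2)) * V\<^sub>0 / 2
        + (\<alpha> n * (sqrt (real n) * c)) * W n y \<psi>\<^sub>0 + \<alpha> n * (R n y \<eta> \<eta>\<^sub>0 - R n y (sh n t \<eta>) \<eta>\<^sub>0)"
      unfolding ab by (simp add: algebra_simps)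
    also have "\<dots> = t\<^sup>2 * V\<^sub>0 / 2 - t * sqrt s * inner \<psi>\<^sub>0 h + t * sqrt s / sqrt (real n) * W n y \<psi>\<^sub>0
        + \<alpha> n * (R n y \<eta> \<eta>\<^sub>0 - R n y (sh n t \<eta>) \<eta>\<^sub>0)"
      unfolding c1 c2 c3 by simp
    finally have ab': "\<alpha> n * (a - b) = t\<^sup>2 * V\<^sub>0 / 2 - t * sqrt s * inner \<psi>\<^sub>0 h
        + t * sqrt s / sqrt (real n) * W n y \<psi>\<^sub>0
        + \<alpha> n * (R n y \<eta> \<eta>\<^sub>0 - R n y (sh n t \<eta>) \<eta>\<^sub>0)" .
    have centred: "\<psi> \<eta> - \<psi>hat n y = inner \<psi>\<^sub>0 h + r \<eta> \<eta>\<^sub>0 - W n y \<psi>\<^sub>0 / sqrt (real n)"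
      using psi by (simp add: \<psi>hat_def)
    \<comment> \<open>The inner product cancels against the functional expansion and
      \<open>W\<close> against the centring; only the variance term and \<open>rem\<close>
      remain.\<close>
    have "t * sqrt s * (\<psi> \<eta> - \<psi>hat n y) + \<alpha> n * (a - b)
        = t * sqrt s * (inner \<psi>\<^sub>0 h + r \<eta> \<eta>\<^sub>0 - W n y \<psi>\<^sub>0 / sqrt (real n))
          + (t\<^sup>2 * V\<^sub>0 / 2 - t * sqrt s * inner \<psi>\<^sub>0 h + t * sqrt s / sqrt (real n) * W n y \<psi>\<^sub>0
          + \<alpha> n * (R n y \<eta> \<eta>\<^sub>0 - R n y (sh n t \<eta>) \<eta>\<^sub>0))"
      by (simp only: ab' centred)
    also have "\<dots> = t\<^sup>2 * V\<^sub>0 / 2 + rem t n y \<eta>"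
      unfolding rem_def s_def[symmetric] by (simp add: algebra_simps)
    finally have "t * sqrt s * (\<psi> \<eta> - \<psi>hat n y) + \<alpha> n * (a - b) = t\<^sup>2 * V\<^sub>0 / 2 + rem t n y \<eta>" .
    then show ?thesis
      using eq unfolding G_def s_def by (simp only:)
  qed
  \<comment> \<open>The two summands are the remainder error and the correction for the posterior
    mass of \<open>A n\<close>. Since \<open>real_of_ereal\<close> sends infinity to 0, the bound is
    invoked only where \<open>supr\<close> is finite.\<close>
  define good where "good t n y d \<longleftrightarrow>
      \<bar>d\<bar> \<le> real_of_ereal \<bar>supr t n y\<bar> + \<bar>ln (measure (post n y) (A n))\<bar> \<and>
      restricted_expectation (post n y) (A n) (G t n y)
        = ennreal (exp (d + t\<^sup>2 * V\<^sub>0 / 2)) * ratio t n y" for t n y d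
  \<comment> \<open>The error is chosen separately at each data point, with default 0 where no good
    value exists; \<open>oP\<close>, being an outer-measure notion, accepts such a choice.\<close>
  define \<delta> where "\<delta> t n y = (if \<exists>d. good t n y d then SOME d. good t n y d else 0)" for t n y
  have good_\<delta>: "\<forall>\<^sub>F n in sequentially. \<forall>y\<in>space (P\<^sub>0 n).
      lan n y \<and> 0 < measure (post n y) (A n) \<and> \<bar>supr t n y\<bar> \<noteq> \<infinity> \<longrightarrow> good t n y (\<delta> t n y)" for t
    using eventually_gt_at_top[of 0] A_in_H shift_in_S[of t] shifted_lik_meas[of t]
  proof eventually_elim
    case (elim n)
    show ?case
    proof (intro ballI impI)
      fix y assume y: "y \<in> space (P\<^sub>0 n)"
        and E: "lan n y \<and> 0 < measure (post n y) (A n) \<and> \<bar>supr t n y\<bar> \<noteq> \<infinity>"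
      have y': "y \<in> space (\<nu> n)"
        using y space_P0 by simp
      have AS: "A n \<subseteq> S"
        using sets.sets_into_space[OF A_measurable[of n]] prior_prob(2)[of n] by simp
      have bnd: "\<bar>rem t n y \<eta>\<bar> \<le> real_of_ereal \<bar>supr t n y\<bar>" if "\<eta> \<in> A n" for \<eta>
      proof -
        have "ereal \<bar>rem t n y \<eta>\<bar> \<le> supr t n y"
          unfolding supr_def using that by (rule SUP_upper)
        also have "\<dots> \<le> \<bar>supr t n y\<bar>"
          by (cases "supr t n y") auto
        finally show ?thesis
          using E by (cases "\<bar>supr t n y\<bar>") auto
      qed
      have "\<exists>d. good t n y d"
      proof (rule restricted_expectation_change_of_likelihood[OF A_measurable frac_lik_meas[OF y'],
            where \<tau> = "sh n t" and G = "G t n y" and d = "rem t n y" and c = "t\<^sup>2 * V\<^sub>0 / 2"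
              and \<epsilon> = "real_of_ereal \<bar>supr t n y\<bar>"])
        show "G t n y \<in> borel_measurable (prior n)"
          unfolding G_def using psi_measurable by measurable
        show "ennreal (G t n y \<eta>) * frac_lik (\<alpha> n) (p n) \<eta> y
            = ennreal (exp (t\<^sup>2 * V\<^sub>0 / 2 + rem t n y \<eta>)) * frac_lik (\<alpha> n) (p n) (sh n t \<eta>) y"
          if "\<eta> \<in> A n" for \<eta>
          using tilt[of n y \<eta> t] that AS elim E by blast
        show "\<exists>d. good t n y d"
          if "\<bar>d\<bar> \<le> real_of_ereal \<bar>supr t n y\<bar>
              + \<bar>ln (measure (frac_posterior (\<alpha> n) (prior n) (p n) y) (A n))\<bar>"
            "restricted_expectation (frac_posterior (\<alpha> n) (prior n) (p n) y) (A n) (G t n y)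
              = ennreal (exp (d + t\<^sup>2 * V\<^sub>0 / 2))
                * shifted_ratio (\<alpha> n) (prior n) (p n) (A n) (sh n t) y" for d
          using that unfolding good_def post_def ratio_def sh_def by blast
      qed (use E elim(4) y' bnd in \<open>auto simp: post_def real_of_ereal_pos\<close>)
      then show "good t n y (\<delta> t n y)"
        unfolding \<delta>_def by (auto intro: someI)
    qed
  qed
  have \<delta>_oP: "oP P\<^sub>0 (\<lambda>n y. ereal (\<delta> t n y))" for t
    unfolding oP_iff_with_prob_tending_to_1
  proof (intro allI impI)
    fix \<epsilon> :: real assume \<epsilon>: "0 < \<epsilon>"
    \<comment> \<open>Half of \<open>\<epsilon>\<close> is reserved for the logarithm of the mass,
      the other half for the supremum.\<close>
    obtain \<kappa> where \<kappa>: "0 < \<kappa>" "\<And>b. \<bar>b - 1\<bar> \<le> \<kappa> \<Longrightarrow> 0 < b \<and> \<bar>ln b\<bar> \<le> \<epsilon> / 2"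
      using abs_ln_le_near_1[of "\<epsilon> / 2"] \<epsilon> by auto
    have "with_prob_tending_to_1 P\<^sub>0 (\<lambda>n y. lan n y \<and> \<bar>supr t n y\<bar> \<le> ereal (\<epsilon> / 2) \<and>
        \<bar>measure (post n y) (A n) - 1\<bar> \<le> \<kappa>)"
      using \<epsilon> \<kappa>(1) by (intro with_prob_tending_to_1_conj wp_lan wp_supr wp_mass) auto
    then show "with_prob_tending_to_1 P\<^sub>0 (\<lambda>n y. \<bar>ereal (\<delta> t n y)\<bar> \<le> ereal \<epsilon>)"
    proof (rule with_prob_tending_to_1_mono)
      show "\<forall>\<^sub>F n in sequentially. \<forall>y\<in>space (P\<^sub>0 n). lan n y \<and> \<bar>supr t n y\<bar> \<le> ereal (\<epsilon> / 2) \<and>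
          \<bar>measure (post n y) (A n) - 1\<bar> \<le> \<kappa> \<longrightarrow> \<bar>ereal (\<delta> t n y)\<bar> \<le> ereal \<epsilon>"
        using good_\<delta>[of t]
      proof eventually_elim
        case (elim n)
        show ?case
        proof (intro ballI impI)
          fix y assume y: "y \<in> space (P\<^sub>0 n)"
            and E: "lan n y \<and> \<bar>supr t n y\<bar> \<le> ereal (\<epsilon> / 2) \<and> \<bar>measure (post n y) (A n) - 1\<bar> \<le> \<kappa>"
          have supr: "\<bar>supr t n y\<bar> \<noteq> \<infinity>" "real_of_ereal \<bar>supr t n y\<bar> \<le> \<epsilon> / 2"
            using conjunct1[OF conjunct2[OF E]] by (cases "supr t n y"; simp)+
          have mass: "0 < measure (post n y) (A n) \<and> \<bar>ln (measure (post n y) (A n))\<bar> \<le> \<epsilon> / 2"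
            using E by (intro \<kappa>(2)) simp
          have "good t n y (\<delta> t n y)"
            by (rule elim[rule_format, OF y]) (simp add: E supr mass)
          then have "\<bar>\<delta> t n y\<bar> \<le> \<epsilon>"
            using supr(2) mass unfolding good_def by linarith
          then show "\<bar>ereal (\<delta> t n y)\<bar> \<le> ereal \<epsilon>"
            by simp
        qed
      qed
    qed
  qed
  have expansion: "with_prob_tending_to_1 P\<^sub>0 (\<lambda>n y. restricted_expectation (post n y) (A n) (G t n y)
      = ennreal (exp (\<delta> t n y + t\<^sup>2 * V\<^sub>0 / 2)) * ratio t n y)" for t
  proof (rule with_prob_tending_to_1_mono)
    \<comment> \<open>The constants 1 and 1/2 only secure a finite supremum and positive
      mass.\<close>
    show "with_prob_tending_to_1 P\<^sub>0 (\<lambda>n y. lan n y \<and> \<bar>supr t n y\<bar> \<le> ereal 1 \<and>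
        \<bar>measure (post n y) (A n) - 1\<bar> \<le> 1 / 2)"
      by (intro with_prob_tending_to_1_conj wp_lan wp_supr wp_mass) auto
    show "\<forall>\<^sub>F n in sequentially. \<forall>y\<in>space (P\<^sub>0 n). lan n y \<and> \<bar>supr t n y\<bar> \<le> ereal 1 \<and>
        \<bar>measure (post n y) (A n) - 1\<bar> \<le> 1 / 2 \<longrightarrow>
        restricted_expectation (post n y) (A n) (G t n y)
          = ennreal (exp (\<delta> t n y + t\<^sup>2 * V\<^sub>0 / 2)) * ratio t n y"
      using good_\<delta>[of t]
    proof eventually_elim
      case (elim n)
      show ?case
      proof (intro ballI impI)
        fix y assume y: "y \<in> space (P\<^sub>0 n)"
          and E: "lan n y \<and> \<bar>supr t n y\<bar> \<le> ereal 1 \<and> \<bar>measure (post n y) (A n) - 1\<bar> \<le> 1 / 2"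
        have "\<bar>supr t n y\<bar> \<noteq> \<infinity>"
          using conjunct1[OF conjunct2[OF E]] by (cases "supr t n y") simp_all
        moreover have "0 < measure (post n y) (A n)"
          using conjunct2[OF conjunct2[OF E]] by linarith
        ultimately have "good t n y (\<delta> t n y)"
          using E by (intro elim[rule_format, OF y]) simp
        then show "restricted_expectation (post n y) (A n) (G t n y)
            = ennreal (exp (\<delta> t n y + t\<^sup>2 * V\<^sub>0 / 2)) * ratio t n y"
          unfolding good_def by blast
      qed
    qed
  qed
  have weak: "weak_conv_in_prob P\<^sub>0
      (\<lambda>n y. distr (post n y) borel (\<lambda>\<eta>. sqrt (real n * \<alpha> n) * (\<psi> \<eta> - \<psi>hat n y))) (gaussian 0 V\<^sub>0)"
    if ratio1: "\<And>t. oP P\<^sub>0 (\<lambda>n y. enn2ereal (ratio t n y) - 1)"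
    unfolding weak_conv_in_prob_def oP_iff_with_prob_tending_to_1
  proof (intro allI impI)
    fix \<epsilon> :: real assume \<epsilon>: "0 < \<epsilon>"
    let ?N = "gaussian 0 V\<^sub>0"
    let ?g = "\<lambda>n y \<eta>. sqrt (real n * \<alpha> n) * (\<psi> \<eta> - \<psi>hat n y)"
    note N = real_distribution_gaussian[OF V, of 0]
    obtain T \<kappa> where T: "finite T" "0 < \<kappa>"
      and bl: "\<And>Q. real_distribution Q \<Longrightarrow>
        (\<And>t. t \<in> T \<Longrightarrow> \<exists>m\<ge>0. (\<integral>\<^sup>+x. ennreal (exp (t * x)) \<partial>Q) = ennreal m \<and>
          \<bar>m - (LINT x|?N. exp (t * x))\<bar> < \<kappa>) \<Longrightarrow> bl_dist Q ?N < \<epsilon> / 2"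
      using bl_dist_of_finitely_many_mgf[OF N gaussian_mgf(1)[OF V], of "\<epsilon> / 2"] \<epsilon> by auto
    \<comment> \<open>This is the closeness hypothesis of the finite criterion, with the Gaussian
      transform evaluated.\<close>
    define near where "near t n y \<longleftrightarrow> (\<exists>m\<ge>0.
        restricted_expectation (post n y) (A n) (G t n y) = ennreal m \<and>
        \<bar>m - exp (t\<^sup>2 * V\<^sub>0 / 2)\<bar> < \<kappa>)" for t n y
    have "with_prob_tending_to_1 P\<^sub>0 (near t)" for t
    proof -
      obtain \<rho> where \<rho>: "0 < \<rho>" "\<And>d x. \<bar>d\<bar> \<le> \<rho> \<Longrightarrow> \<bar>x - 1\<bar> \<le> \<rho> \<Longrightarrow>
          \<bar>exp (d + t\<^sup>2 * V\<^sub>0 / 2) * x - exp (t\<^sup>2 * V\<^sub>0 / 2)\<bar> < \<kappa>"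
        using exp_times_near[OF T(2), of "t\<^sup>2 * V\<^sub>0 / 2"] by blast
      have "with_prob_tending_to_1 P\<^sub>0 (\<lambda>n y. restricted_expectation (post n y) (A n) (G t n y)
          = ennreal (exp (\<delta> t n y + t\<^sup>2 * V\<^sub>0 / 2)) * ratio t n y \<and>
          \<bar>ereal (\<delta> t n y)\<bar> \<le> ereal \<rho> \<and> \<bar>enn2ereal (ratio t n y) - 1\<bar> \<le> ereal \<rho>)"
        using \<delta>_oP[of t] ratio1[of t] \<rho>(1) unfolding oP_iff_with_prob_tending_to_1
        by (intro with_prob_tending_to_1_conj expansion) auto
      then show ?thesis
      proof (rule with_prob_tending_to_1_mono, intro always_eventually allI ballI impI)
        fix n y
        assume E: "restricted_expectation (post n y) (A n) (G t n y)
          = ennreal (exp (\<delta> t n y + t\<^sup>2 * V\<^sub>0 / 2)) * ratio t n y \<and>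
          \<bar>ereal (\<delta> t n y)\<bar> \<le> ereal \<rho> \<and> \<bar>enn2ereal (ratio t n y) - 1\<bar> \<le> ereal \<rho>"
        \<comment> \<open>Closeness to 1 excludes an infinite ratio.\<close>
        obtain x where x: "ratio t n y = ennreal x" "0 \<le> x"
          using E by (cases "ratio t n y") auto
        have "\<bar>x - 1\<bar> \<le> \<rho>"
          using E x by (simp add: one_ereal_def)
        then show "near t n y"
          unfolding near_def using E x \<rho>(2)[of "\<delta> t n y" x]
          by (intro exI[of _ "exp (\<delta> t n y + t\<^sup>2 * V\<^sub>0 / 2) * x"]) (auto simp: ennreal_mult')
      qed
    qed
    \<comment> \<open>The bound 1/2 keeps the mass of \<open>A n\<close> positive. The bound
      \<open>\<epsilon> / 4\<close> is doubled by \<open>bl_dist_condition\<close> and adds to the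
      \<open>\<epsilon> / 2\<close> of the conditioned law. Finiteness of \<open>T\<close> lets the
      events be intersected.\<close>
    then have "with_prob_tending_to_1 P\<^sub>0 (\<lambda>n y. (\<forall>t\<in>T. near t n y) \<and>
        \<bar>measure (post n y) (A n) - 1\<bar> \<le> min (1 / 2) (\<epsilon> / 4))"
      using T(1) \<epsilon>
      by (intro with_prob_tending_to_1_conj with_prob_tending_to_1_finite_ball wp_mass) auto
    then show "with_prob_tending_to_1 P\<^sub>0 (\<lambda>n y. \<bar>ereal (bl_dist (distr (post n y) borel (?g n y)) ?N)\<bar> \<le> ereal \<epsilon>)"
    proof (rule with_prob_tending_to_1_mono, intro always_eventually allI ballI impI)
      fix n y
      assume "y \<in> space (P\<^sub>0 n)"
        and E: "(\<forall>t\<in>T. near t n y) \<and> \<bar>measure (post n y) (A n) - 1\<bar> \<le> min (1 / 2) (\<epsilon> / 4)"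
      then have y: "y \<in> space (\<nu> n)"
        by (simp add: space_P0)
      have mass: "\<bar>measure (post n y) (A n) - 1\<bar> \<le> 1 / 2" "\<bar>measure (post n y) (A n) - 1\<bar> \<le> \<epsilon> / 4"
        using E by simp_all
      have pos: "0 < measure (post n y) (A n)"
        using mass(1) by linarith
      have prob: "prob_space (post n y)"
        using prob_space_frac_posterior[OF frac_lik_meas[OF y] A_measurable] pos
        unfolding post_def by blast
      interpret post: prob_space "post n y" by (rule prob)
      note [measurable_cong] = sets_post[of n y]
      have [measurable]: "?g n y \<in> borel_measurable (post n y)" "A n \<in> sets (post n y)"
        using psi_measurable[of n] A_measurable[of n] by measurable
      interpret U: prob_space "uniform_measure (post n y) (A n)"
        using pos by (intro prob_space_uniform_measure) (auto simp: post.emeasure_eq_measure)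
      let ?Q = "distr (uniform_measure (post n y) (A n)) borel (?g n y)"
      have Q: "real_distribution ?Q" and Q0: "real_distribution (distr (post n y) borel (?g n y))"
        by (auto simp: real_distribution_def real_distribution_axioms_def
            intro!: U.prob_space_distr post.prob_space_distr)
      have combine: "b \<le> \<epsilon>" if "a < \<epsilon> / 2" "b \<le> a + 2 * (1 - m)" "\<bar>m - 1\<bar> \<le> \<epsilon> / 4" for a b m :: real
        using that by argo
      have "(\<integral>\<^sup>+x. ennreal (exp (t * x)) \<partial>?Q) = restricted_expectation (post n y) (A n) (G t n y)" for t
      proof -
        have "(\<lambda>\<eta>. exp (t * ?g n y \<eta>)) = G t n y"
          by (simp add: G_def fun_eq_iff mult.assoc)
        then show ?thesis
          by (subst nn_integral_distr_uniform_measure) simp_all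
      qed
      then have "bl_dist ?Q ?N < \<epsilon> / 2"
        using E by (intro bl[OF Q]) (auto simp: near_def gaussian_mgf(2)[OF V])
      moreover have "bl_dist (distr (post n y) borel (?g n y)) ?N
          \<le> bl_dist ?Q ?N + 2 * (1 - measure (post n y) (A n))"
        by (rule bl_dist_condition[OF prob _ _ pos N]) measurable
      ultimately have "bl_dist (distr (post n y) borel (?g n y)) ?N \<le> \<epsilon>"
        using mass(2) by (rule combine)
      then show "\<bar>ereal (bl_dist (distr (post n y) borel (?g n y)) ?N)\<bar> \<le> ereal \<epsilon>"
        using bl_dist_nonneg[OF Q0 N] by simp
    qed
  qed
  show ?thesis
  proof (intro conjI allI impI)
    show "\<exists>\<delta> :: nat \<Rightarrow> 'y \<Rightarrow> real. oP P\<^sub>0 (\<lambda>n y. ereal (\<delta> n y)) \<and>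
        with_prob_tending_to_1 P\<^sub>0 (\<lambda>n y.
          restricted_expectation (post n y) (A n)
              (\<lambda>\<eta>. exp (t * sqrt (real n * \<alpha> n) * (\<psi> \<eta> - \<psi>hat n y)))
            = ennreal (exp (\<delta> n y + t\<^sup>2 * V\<^sub>0 / 2)) * ratio t n y)" for t
      using \<delta>_oP[of t] expansion[of t] unfolding G_def by (intro exI[of _ "\<delta> t"] conjI)
  qed (rule weak, blast)
qed

end
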